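(* Fix $W>0$. For $N\ge1$, consider channel configurations $\mathcal{W}=\bigcup_{n=1}^N\mathcal{W}_n$ with $\mathcal{W}_n=\{\omega:|\omega-\overline{\omega}_n|\le W/2\}$ pairwise disjoint (all of equal width $W$) satisfying $$(\mathcal{W}_{n_1}+\mathcal{W}_{n_2})\cap(\mathcal{W}_n+\mathcal{W}_{n_3})=\emptyset$$ for all $n_1,n_2,n,n_3\in\{1,\ldots,N\}$ with $(n_1,n_2)\ne(n,n_3)$ and $(n_1,n_2)\ne(n_3,n)$. Let $\eta(N)$ be the optimal (largest) spectral filling efficiency $$\frac{\sum_{n=1}^N W_n}{\max\mathcal{W}-\min\mathcal{W}}=\frac{NW}{\max\mathcal{W}-\min\mathcal{W}}$$ over all such configurations with $N$ channels. Then $\eta(N)\in\mathcal{O}(1/N)$ and $$\lim_{N\to\infty}\eta(N)\,N=\frac12.$$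
   Context: $\mathcal{A}+\mathcal{B}=\{a+b:a\in\mathcal{A},b\in\mathcal{B}\}$. The displayed disjointness condition is the condition under which the nonlinear Schrödinger fiber channel with ideal distributed brick-wall filters onto $\mathcal{W}$ conserves the energy in each channel separately (energy-decoupled system). *)

theory Defs
  imports "HOL-Analysis.Analysis" "HOL-Library.Set_Algebras" "HOL-Library.Landau_Symbols"
begin

definition chan :: "real \<Rightarrow> real \<Rightarrow> real set" where
  "chan W c = {\<omega>. \<bar>\<omega> - c\<bar> \<le> W / 2}"

definition valid_config :: "real \<Rightarrow> nat \<Rightarrow> (nat \<Rightarrow> real) \<Rightarrow> bool" where
  "valid_config W N c \<longleftrightarrow>
     (\<forall>i\<in>{1..N}. \<forall>j\<in>{1..N}. i \<noteq> j \<longrightarrow> chan W (c i) \<inter> chan W (c j) = {}) \<and>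
     (\<forall>n1\<in>{1..N}. \<forall>n2\<in>{1..N}. \<forall>n\<in>{1..N}. \<forall>n3\<in>{1..N}.
        (n1, n2) \<noteq> (n, n3) \<and> (n1, n2) \<noteq> (n3, n) \<longrightarrow>
        (chan W (c n1) + chan W (c n2)) \<inter> (chan W (c n) + chan W (c n3)) = {})"

definition config_set :: "real \<Rightarrow> nat \<Rightarrow> (nat \<Rightarrow> real) \<Rightarrow> real set" where
  "config_set W N c = (\<Union>n\<in>{1..N}. chan W (c n))"

definition efficiency :: "real \<Rightarrow> nat \<Rightarrow> (nat \<Rightarrow> real) \<Rightarrow> real" where
  "efficiency W N c = (real N * W) / (Sup (config_set W N c) - Inf (config_set W N c))"

definition eta :: "real \<Rightarrow> nat \<Rightarrow> real" where
  "eta W N = Sup (efficiency W N ` {c. valid_config W N c})"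

end

theory Submission
  imports Defs "HOL-Complex_Analysis.Complex_Analysis" "HOL-Number_Theory.Number_Theory"
    "HOL-Real_Asymp.Real_Asymp"
begin

text \<open>
  Two channel sums are disjoint iff the sums of their centres differ by more than \<open>2W\<close>, so after
  rescaling one asks for the shortest interval containing a real Sidon set of size \<open>N\<close> whose sums are
  \<open>1\<close>-separated. Its length is asymptotic to \<open>N\<^sup>2\<close>.

  Lower bound for the length (Erdos--Turan, Lindstrom): all differences of points at most \<open>R\<close> positions
  apart are \<open>1\<close>-separated, so their sum is large, whereas telescoping bounds that sum by
  \<open>R (R + 1) / 2\<close> times the length.

  Upper bound: Ruzsa's Sidon set modulo \<open>p (p - 1)\<close> has \<open>p - 1\<close> elements. Covering every \<open>N\<close> needs a prime
  in \<open>(N, (1 + \<epsilon>) N]\<close> for all large \<open>N\<close>. This is obtained by the Wiener--Ikehara method: since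
  \<open>\<zeta>\<close> has no zeros on the line \<open>Re s = 1\<close>, the function \<open>- \<zeta>'/\<zeta> - \<zeta>\<close> is holomorphic near that line, and testing
  it against Fejer kernels shows that prime powers, weighted by \<open>\<Lambda>(n)/n\<close>, have the same density
  on the logarithmic scale as the integers weighted by \<open>1/n\<close>.
\<close>

section \<open>The zeta function on the right half-plane\<close>

text \<open>The condition separates distinct sums of centres by more than 2 W, so a span close to 2
  W N^2 gives efficiency N W / (2 W N^2) = 1 / (2 N). The extra channel width in the total span is
  of lower order. A prime known only to lie in (N, 2 N] could lengthen Ruzsa's set by a factor 4,
  which would spoil the constant 1/2; hence the need for primes close to N. The analytic target is a
  single prime with ln p within \<epsilon> of u. If there were none, the Fejer mass of \<Lambda> at
  u would come only from points at distance at least \<epsilon>, where the kernel is O(1/T) times a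
  Cauchy kernel, and from proper prime powers, whose weights form a convergent series. The integers
  keep a mass of at least 1/24 for every T. For this comparison the Cauchy mass of \<Lambda> must be
  bounded independently of T, which the kernel with T = 1 provides. Every passage to \<sigma> = 1 is
  made on finite partial sums, with nonnegative terms controlling the rest. In the Lindstrom bound R
  stays fixed while N grows; this costs a factor (R + 1) / R, and R is taken large at the
  end.\<close>

definition zeta_reg_term :: "nat \<Rightarrow> complex \<Rightarrow> complex" where
  "zeta_reg_term m s = (s - 1) * of_nat (Suc m) powr (-s)
     + (of_nat (Suc (Suc m)) powr (1 - s) - of_nat (Suc m) powr (1 - s))"

text \<open>The regularised function \<open>(s - 1) \<zeta>(s)\<close>: the terms compare \<open>n\<^sup>-\<^sup>s\<close> with the integral of
  \<open>x\<^sup>-\<^sup>s\<close> over \<open>[n, n + 1]\<close>.\<close>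

definition zeta_reg :: "complex \<Rightarrow> complex" where
  "zeta_reg s = 1 + (\<Sum>m. zeta_reg_term m s)"

lemma norm_of_nat_powr: "norm (of_nat n powr s :: complex) = real n powr Re s"
  by (cases "n = 0") (auto simp: norm_powr_real_powr)

text \<open>The term is the first-order Taylor remainder of x^(1 - s) at m + 1 with step 1. The
  second derivative gains a factor 1/m over the individual summands, which extends convergence from
  Re s > 1 to Re s > 0.\<close>

lemma norm_zeta_reg_term_le:
  assumes "Re s > 0"
  shows "norm (zeta_reg_term m s) \<le> norm (s - 1) * norm s * real (Suc m) powr (- Re s - 1)"
proof -
  define f :: "nat \<Rightarrow> complex \<Rightarrow> complex" where
    "f = (\<lambda>i x. if i = 0 then x powr (1 - s) else if i = 1 then (1 - s) * x powr (-s)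
              else (1 - s) * (-s) * x powr (-s - 1))"
  let ?w = "of_nat (Suc m) :: complex" and ?z = "of_nat (Suc (Suc m)) :: complex"
  have seg: "x \<in> closed_segment ?w ?z \<Longrightarrow> Im x = 0 \<and> Re x \<ge> real (Suc m)" for x
    by (auto simp: closed_segment_def scaleR_conv_of_real algebra_simps)
  have "norm (f 0 ?z - (\<Sum>i\<le>1. f i ?w * (?z - ?w) ^ i / fact i))
          \<le> (norm (s - 1) * norm s * real (Suc m) powr (- Re s - 1)) * norm (?z - ?w) ^ Suc 1 / fact 1"
  proof (rule complex_Taylor)
    fix i :: nat and x assume x: "x \<in> closed_segment ?w ?z" and i: "i \<le> 1"
    have x0: "x \<notin> \<real>\<^sub>\<le>\<^sub>0" using seg[OF x] by (auto elim!: nonpos_Reals_cases)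
    show "(f i has_field_derivative f (Suc i) x) (at x within closed_segment ?w ?z)"
    proof (cases "i = 0")
      case True
      show ?thesis using True has_field_derivative_powr[OF x0, of "1 - s"]
        by (auto simp: f_def intro: has_field_derivative_at_within)
    next
      case False
      then have "i = 1" using i by simp
      then show ?thesis
        using DERIV_cmult[OF has_field_derivative_powr[OF x0, of "- s"], of "1 - s"]
        by (auto simp: f_def mult.assoc intro: has_field_derivative_at_within)
    qed
  next
    fix x assume x: "x \<in> closed_segment ?w ?z"
    have "norm (x powr (-s - 1)) = Re x powr (- Re s - 1)"
      using seg[OF x] by (subst norm_powr_real_powr) (auto simp: complex_is_Real_iff)
    also have "\<dots> \<le> real (Suc m) powr (- Re s - 1)"
      using seg[OF x] assms by (intro powr_mono2') auto
    finally show "norm (f (Suc 1) x) \<le> norm (s - 1) * norm s * real (Suc m) powr (- Re s - 1)"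
      by (simp add: f_def norm_mult norm_minus_commute mult_left_mono)
  qed auto
  moreover have "f 0 ?z - (\<Sum>i\<le>1. f i ?w * (?z - ?w) ^ i / fact i) = zeta_reg_term m s"
    by (simp add: f_def zeta_reg_term_def algebra_simps)
  ultimately show ?thesis by simp
qed

lemma summable_Suc_powr: "a < -1 \<Longrightarrow> summable (\<lambda>m. real (Suc m) powr a)"
  using summable_real_powr_iff[of a] summable_Suc_iff[of "\<lambda>n. real n powr a"] by simp

lemma open_Re_gt: "open {s. Re s > a}"
  by (simp add: open_halfspace_Re_gt)

lemma zeta_reg_holomorphic: "zeta_reg holomorphic_on {s. Re s > 0}"
proof -
  define d where "d = (\<lambda>m s. deriv (zeta_reg_term m) s)"
  have "\<exists>g g'. \<forall>x\<in>{s. Re s > 0}. ((\<lambda>n. zeta_reg_term n x) sums g x) \<and> ((\<lambda>n. d n x) sums g' x)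
           \<and> (g has_field_derivative g' x) (at x)"
  proof (rule series_and_derivative_comparison_local[OF open_Re_gt])
    fix n x
    have "zeta_reg_term n holomorphic_on UNIV"
      unfolding zeta_reg_term_def by (intro holomorphic_intros)
    then show "(zeta_reg_term n has_field_derivative d n x) (at x)"
      unfolding d_def using holomorphic_derivI by blast
  next
    fix x assume x: "x \<in> {s. Re s > 0}"
    \<comment> \<open>On the ball of this radius the real part stays at least r, so one exponent -r
      - 1 < -1 dominates all terms.\<close>
    define r where "r = Re x / 2"
    have r: "r > 0" using x by (simp add: r_def)
    define B where "B = (norm x + r + 1) * (norm x + r)"
    show "\<exists>\<delta> h. 0 < \<delta> \<and> summable h \<and> (\<forall>\<^sub>F n in sequentially.
        \<forall>y\<in>ball x \<delta> \<inter> {s. Re s > 0}. norm (zeta_reg_term n y) \<le> h n)"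
    proof (intro exI conjI always_eventually allI ballI)
      show "r > 0" by fact
      show "summable (\<lambda>n. B * real (Suc n) powr (- r - 1))"
        by (intro summable_mult summable_Suc_powr) (use r in simp)
      fix n y assume y: "y \<in> ball x r \<inter> {s. Re s > 0}"
      have "norm (y - x) < r" using y by (simp add: dist_norm norm_minus_commute)
      then have n1: "norm y \<le> norm x + r" and n3: "\<bar>Re (y - x)\<bar> < r"
        using norm_triangle_ineq2[of y x] abs_Re_le_cmod[of "y - x"] by linarith+
      have n2: "norm (y - 1) \<le> norm x + r + 1"
        using norm_triangle_ineq4[of y 1] n1 by simp
      have "r \<le> Re y" using n3 unfolding r_def by (auto simp: abs_if split: if_splits)
      have "norm (zeta_reg_term n y) \<le> norm (y - 1) * norm y * real (Suc n) powr (- Re y - 1)"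
        using y by (intro norm_zeta_reg_term_le) auto
      also have "\<dots> \<le> B * real (Suc n) powr (- r - 1)"
        unfolding B_def using n1 n2 \<open>r \<le> Re y\<close> r by (intro mult_mono powr_mono) auto
      finally show "norm (zeta_reg_term n y) \<le> B * real (Suc n) powr (- r - 1)" .
    qed
  qed
  then obtain g g' where g: "\<And>x. Re x > 0 \<Longrightarrow> (\<lambda>n. zeta_reg_term n x) sums g x"
      "\<And>x. Re x > 0 \<Longrightarrow> (g has_field_derivative g' x) (at x)"
    by auto
  have "(\<lambda>s. 1 + g s) holomorphic_on {s. Re s > 0}"
    by (intro holomorphic_intros) (use g(2) in \<open>auto simp: holomorphic_on_open[OF open_Re_gt]\<close>)
  then show ?thesis
    by (rule holomorphic_transform) (use g(1) in \<open>auto simp: zeta_reg_def sums_iff\<close>)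
qed

lemma zeta_reg_1 [simp]: "zeta_reg 1 = 1"
  by (simp add: zeta_reg_def zeta_reg_term_def del: of_nat_Suc)

lemma summable_of_nat_powr: "Re s > 1 \<Longrightarrow> summable (\<lambda>n. of_nat n powr (-s) :: complex)"
  by (rule summable_norm_cancel) (simp add: norm_of_nat_powr summable_real_powr_iff)

text \<open>For Re s > 1 the correction terms telescope to -1, which cancels the leading 1 of
  \<open>zeta_reg\<close>.\<close>

lemma zeta_sums:
  assumes "Re s > 1"
  shows "(\<lambda>n. of_nat n powr (-s)) sums (zeta_reg s / (s - 1))"
proof -
  have s1: "s \<noteq> 1" using assms by auto
  have "(\<lambda>n. of_nat n powr (-s) :: complex) sums (\<Sum>n. of_nat n powr (-s))"
    using summable_of_nat_powr[OF assms] by (rule summable_sums)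
  \<comment> \<open>The summand at n = 0 vanishes because \<open>0 powr z = 0\<close>, so series
    over all naturals agree with the usual ones over n \<ge> 1.\<close>
  then have 1: "(\<lambda>m. of_nat (Suc m) powr (-s) :: complex) sums (\<Sum>n. of_nat n powr (-s))"
    by (subst sums_Suc_iff) simp
  have "(\<lambda>m. norm (of_nat (Suc m) powr (1 - s) :: complex)) \<longlonglongrightarrow> 0"
    unfolding norm_of_nat_powr
    using assms by (intro tendsto_neg_powr filterlim_compose[OF filterlim_real_sequentially filterlim_Suc]) auto
  then have "(\<lambda>m. of_nat (Suc m) powr (1 - s) :: complex) \<longlonglongrightarrow> 0"
    by (rule tendsto_norm_zero_cancel)
  then have "(\<lambda>m. of_nat (Suc (Suc m)) powr (1 - s) - of_nat (Suc m) powr (1 - s) :: complex)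
               sums (0 - of_nat (Suc 0) powr (1 - s))"
    by (rule telescope_sums)
  from sums_add[OF sums_mult[OF 1, of "s - 1"] this]
  have "(\<lambda>m. zeta_reg_term m s) sums ((s - 1) * (\<Sum>n. of_nat n powr (-s)) - 1)"
    by (simp add: zeta_reg_term_def)
  then have "zeta_reg s = (s - 1) * (\<Sum>n. of_nat n powr (-s))"
    by (simp add: zeta_reg_def sums_iff)
  then show ?thesis using summable_sums[OF summable_of_nat_powr[OF assms]] s1 by simp
qed

section \<open>The Dirichlet series of the von Mangoldt function\<close>

lemma summable_ln_powr:
  assumes "\<sigma> > 1"
  shows "summable (\<lambda>n. ln (real n) * real n powr (-\<sigma>))"
proof (rule summable_comparison_test'[where N = 1])
  define d where "d = (\<sigma> - 1) / 2"
  have d: "d > 0" using assms by (simp add: d_def)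
  show "summable (\<lambda>n. (1 / d) * real n powr (- \<sigma> + d))"
    using assms by (intro summable_mult) (auto simp: summable_real_powr_iff d_def field_simps)
  fix n :: nat assume n: "n \<ge> 1"
  have "ln (real n) = ln (real n powr d) / d" using n d by (simp add: ln_powr)
  also have "\<dots> \<le> real n powr d / d"
    using n d ln_le_minus_one[of "real n powr d"] by (intro divide_right_mono) auto
  finally have "ln (real n) * real n powr (-\<sigma>) \<le> real n powr d / d * real n powr (-\<sigma>)"
    by (intro mult_right_mono) auto
  also have "\<dots> = (1 / d) * real n powr (- \<sigma> + d)" by (simp flip: powr_add add: add.commute)
  finally show "norm (ln (real n) * real n powr (-\<sigma>)) \<le> (1 / d) * real n powr (- \<sigma> + d)"
    using n by (simp add: abs_mult)
qed

lemma zeta_deriv_sums: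
  assumes "Re s > 1"
  shows "(\<lambda>n. of_real (ln (real n)) * of_nat n powr (-s)) sums
           (- deriv (\<lambda>s. zeta_reg s / (s - 1)) s)"
proof -
  have "\<exists>g g'. \<forall>x\<in>{s. Re s > 1}. ((\<lambda>n. of_nat n powr (-x)) sums g x) \<and>
          ((\<lambda>n. - (of_real (ln (real n)) * of_nat n powr (-x))) sums g' x)
           \<and> (g has_field_derivative g' x) (at x)"
  proof (rule series_and_derivative_comparison_local[OF open_Re_gt])
    fix n :: nat and x :: complex
    show "((\<lambda>x. of_nat n powr (-x)) has_field_derivative
            - (of_real (ln (real n)) * of_nat n powr (-x))) (at x)"
    proof (cases "n = 0")
      case False
      then show ?thesis
        using DERIV_chain2[OF has_field_derivative_powr_right[of "of_nat n" "-x"] DERIV_minus[OF DERIV_ident]]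
        by (simp add: Ln_of_nat)
    qed auto
  next
    fix x :: complex assume x: "x \<in> {s. Re s > 1}"
    define r where "r = (Re x - 1) / 2"
    have r: "r > 0" using x by (simp add: r_def)
    show "\<exists>\<delta> h. 0 < \<delta> \<and> summable h \<and> (\<forall>\<^sub>F n in sequentially.
        \<forall>y\<in>ball x \<delta> \<inter> {s. Re s > 1}. norm (of_nat n powr (-y) :: complex) \<le> h n)"
    proof (intro exI conjI eventually_mono[OF eventually_ge_at_top[of 1]] ballI)
      show "r > 0" by fact
      show "summable (\<lambda>n. real n powr (- r - 1))"
        using r by (auto simp: summable_real_powr_iff)
      fix n :: nat and y :: complex assume n: "n \<ge> 1" and y: "y \<in> ball x r \<inter> {s. Re s > 1}"
      have "\<bar>Re (y - x)\<bar> < r"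
        using y abs_Re_le_cmod[of "y - x"] by (simp add: dist_norm norm_minus_commute)
      then have "1 + r \<le> Re y" unfolding r_def by (auto simp: abs_if field_simps split: if_splits)
      then show "norm (of_nat n powr (-y) :: complex) \<le> real n powr (- r - 1)"
        unfolding norm_of_nat_powr using n by (intro powr_mono) auto
    qed
  qed
  then obtain g g' where g: "\<And>x. Re x > 1 \<Longrightarrow> (\<lambda>n. of_nat n powr (-x)) sums g x"
      "\<And>x. Re x > 1 \<Longrightarrow> (\<lambda>n. - (of_real (ln (real n)) * of_nat n powr (-x))) sums g' x"
      "\<And>x. Re x > 1 \<Longrightarrow> (g has_field_derivative g' x) (at x)"
    unfolding mem_Collect_eq Ball_def by blast
  have eq: "g x = zeta_reg x / (x - 1)" if "Re x > 1" for x
    using g(1)[OF that] zeta_sums[OF that] sums_unique2 by blast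
  have "((\<lambda>s. zeta_reg s / (s - 1)) has_field_derivative g' s) (at s)"
    by (rule has_field_derivative_transform_within_open[OF g(3) open_Re_gt[of 1]])
       (use assms eq in auto)
  then have "deriv (\<lambda>s. zeta_reg s / (s - 1)) s = g' s" by (rule DERIV_imp_deriv)
  then show ?thesis using sums_minus[OF g(2)[OF assms]] by simp
qed

lemma summable_mangoldt_powr:
  assumes "\<sigma> > 1"
  shows "summable (\<lambda>n. mangoldt n * real n powr (-\<sigma>))"
proof (rule summable_comparison_test'[where N = 1, OF summable_ln_powr[OF assms]])
  fix n :: nat assume "n \<ge> 1"
  then show "norm (mangoldt n * real n powr (-\<sigma>)) \<le> ln (real n) * real n powr (-\<sigma>)"
    by (auto simp: abs_mult intro!: mult_right_mono mangoldt_le)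
qed

definition mangoldt_series :: "complex \<Rightarrow> complex" where
  "mangoldt_series s = (\<Sum>n. mangoldt n * of_nat n powr (-s))"

lemma mangoldt_series_sums:
  assumes "Re s > 1"
  shows "(\<lambda>n. mangoldt n * of_nat n powr (-s)) sums mangoldt_series s"
  unfolding mangoldt_series_def
  by (rule summable_sums, rule summable_norm_cancel)
     (use summable_mangoldt_powr[OF assms] in \<open>simp add: norm_mult norm_of_nat_powr\<close>)

text \<open>This is the convolution identity that \<Lambda> summed over the divisors of n gives ln
  n. Absolute convergence allows the double sum over (d, m) to be regrouped by n = d m.\<close>

lemma mangoldt_series_times_zeta:
  assumes "Re s > 1"
  shows "mangoldt_series s * (zeta_reg s / (s - 1)) = - deriv (\<lambda>s. zeta_reg s / (s - 1)) s"
proof -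
  let ?P = "{1..} :: nat set"
  define f where "f = (\<lambda>n. mangoldt n * of_nat n powr (-s) :: complex)"
  define g where "g = (\<lambda>n. of_nat n powr (-s) :: complex)"
  have sf: "summable (\<lambda>n. norm (f n))" and sg: "summable (\<lambda>n. norm (g n))"
    using summable_mangoldt_powr[OF assms] assms
    by (simp_all add: f_def g_def norm_mult norm_of_nat_powr summable_real_powr_iff)
  have fs: "f sums mangoldt_series s" and gs: "g sums (zeta_reg s / (s - 1))"
    using mangoldt_series_sums[OF assms] zeta_sums[OF assms] by (simp_all add: f_def g_def)
  have "(f has_sum mangoldt_series s) UNIV" "(g has_sum (zeta_reg s / (s - 1))) UNIV"
    using norm_summable_imp_has_sum[OF sf fs] norm_summable_imp_has_sum[OF sg gs] by blast+
  \<comment> \<open>Index 0 is removed here because the regrouping below identifies factor pairs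
    with divisors, which works only for positive integers.\<close>
  moreover have "(f has_sum c) UNIV \<longleftrightarrow> (f has_sum c) ?P" "(g has_sum c) UNIV \<longleftrightarrow> (g has_sum c) ?P" for c
    by (rule has_sum_cong_neutral; simp add: f_def g_def not_le)+
  ultimately have fh: "(f has_sum mangoldt_series s) ?P" and gh: "(g has_sum (zeta_reg s / (s - 1))) ?P"
    by blast+
  have fa: "(\<lambda>n. norm (f n)) summable_on ?P" and ga: "(\<lambda>n. norm (g n)) summable_on ?P"
    by (rule summable_on_subset_banach[of _ UNIV], rule norm_summable_imp_summable_on,
        use sf sg in simp_all)+
  have "(\<lambda>z. norm (case z of (d, m) \<Rightarrow> f d * g m)) summable_on (?P \<times> ?P)"
    unfolding Infinite_Sum.abs_summable_on_Sigma_iff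
  proof (intro conjI ballI)
    fix d
    show "(\<lambda>m. norm (case (d, m) of (d, m) \<Rightarrow> f d * g m)) summable_on ?P"
      unfolding prod.case norm_mult by (rule summable_on_cmult_right[OF ga])
  next
    have "(\<lambda>d. norm (norm (f d) * (\<Sum>\<^sub>\<infinity>m\<in>?P. norm (g m)))) summable_on ?P"
      unfolding real_norm_def abs_mult abs_norm_cancel by (rule summable_on_cmult_left[OF fa])
    then show "(\<lambda>d. norm (\<Sum>\<^sub>\<infinity>m\<in>?P. norm (case (d, m) of (d, m) \<Rightarrow> f d * g m))) summable_on ?P"
      unfolding prod.case norm_mult infsum_cmult_right' .
  qed
  then have "(\<lambda>(d, m). f d * g m) summable_on (?P \<times> ?P)"
    by (rule abs_summable_summable)
  then have "((\<lambda>(d, m). f d * g m) has_sum (mangoldt_series s * (zeta_reg s / (s - 1)))) (?P \<times> ?P)"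
    by (intro has_sum_SigmaI[where g = "\<lambda>d. f d * (zeta_reg s / (s - 1))"] has_sum_cmult_left fh)
       (simp_all only: prod.case has_sum_cmult_right gh)
  moreover have "((\<lambda>(d, m). f d * g m) has_sum c) (?P \<times> ?P) \<longleftrightarrow>
      ((\<lambda>(n, d). mangoldt d * of_nat n powr (-s)) has_sum c) (SIGMA n:?P. {d. d dvd n})" for c
  proof (rule has_sum_reindex_bij_witness[where i = "\<lambda>(n, d). (d, n div d)" and j = "\<lambda>(d, m). (d * m, d)"])
    fix a :: "nat \<times> nat" assume "a \<in> ?P \<times> ?P"
    then show "(case case a of (d, m) \<Rightarrow> (d * m, d) of (n, d) \<Rightarrow> mangoldt d * of_nat n powr (-s)) =
               (case a of (d, m) \<Rightarrow> f d * g m)"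
      using powr_times_real[of "of_nat (fst a)" "of_nat (snd a)" "-s"]
      by (auto simp: f_def g_def)
  next
    fix b :: "nat \<times> nat" assume b: "b \<in> (SIGMA n:?P. {d. d dvd n})"
    obtain n d where nd: "b = (n, d)" by (cases b)
    then have *: "d dvd n" "n > 0" "d > 0" using b by (auto intro!: Nat.gr0I)
    then have "n div d > 0" by (simp add: div_greater_zero_iff dvd_imp_le)
    then show "(case b of (n, d) \<Rightarrow> (d, n div d)) \<in> ?P \<times> ?P" using * nd by simp
    show "(case case b of (n, d) \<Rightarrow> (d, n div d) of (d, m) \<Rightarrow> (d * m, d)) = b" using * nd by simp
  qed auto
  ultimately have "((\<lambda>(n, d). mangoldt d * of_nat n powr (-s)) has_sum
      (mangoldt_series s * (zeta_reg s / (s - 1)))) (SIGMA n:?P. {d. d dvd n})" by blast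
  then have "((\<lambda>n. of_real (ln (real n)) * of_nat n powr (-s)) has_sum
      (mangoldt_series s * (zeta_reg s / (s - 1)))) ?P"
  proof (rule has_sum_SigmaD)
    fix n :: nat assume n: "n \<in> ?P"
    have "(\<Sum>d | d dvd n. mangoldt d * of_nat n powr (-s)) = of_real (ln (real n)) * of_nat n powr (-s)"
      using n by (subst sum_distrib_right[symmetric], subst mangoldt_sum) auto
    then show "((\<lambda>d. case (n, d) of (n, d) \<Rightarrow> mangoldt d * of_nat n powr (-s)) has_sum
        of_real (ln (real n)) * of_nat n powr (-s)) {d. d dvd n}"
      using n by (auto intro!: has_sum_finiteI)
  qed
  moreover have "((\<lambda>n. of_real (ln (real n)) * of_nat n powr (-s)) has_sum c) ?P \<longleftrightarrow>
      ((\<lambda>n. of_real (ln (real n)) * of_nat n powr (-s)) has_sum c) UNIV" for c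
    by (rule has_sum_cong_neutral) (auto simp: not_le)
  ultimately have "(\<lambda>n. of_real (ln (real n)) * of_nat n powr (-s)) sums
      (mangoldt_series s * (zeta_reg s / (s - 1)))"
    by (intro has_sum_imp_sums) blast
  then show ?thesis using zeta_deriv_sums[OF assms] sums_unique2 by blast
qed

text \<open>This is the logarithmic derivative of \<open>zeta_reg s / (s - 1)\<close>, kept
  multiplied by \<open>zeta_reg w\<close> so that it is available before non-vanishing has been
  established.\<close>

lemma mangoldt_series_eq:
  assumes "Re w > 1"
  shows "mangoldt_series w * zeta_reg w = zeta_reg w / (w - 1) - deriv zeta_reg w"
proof -
  have w: "w - 1 \<noteq> 0" using assms by auto
  have d: "(zeta_reg has_field_derivative deriv zeta_reg w) (at w)"
    using holomorphic_derivI[OF zeta_reg_holomorphic open_Re_gt] assms by simp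
  have "((\<lambda>s. zeta_reg s / (s - 1)) has_field_derivative
      (deriv zeta_reg w * (w - 1) - zeta_reg w) / ((w - 1) * (w - 1))) (at w)"
    using w by (auto intro!: derivative_eq_intros d)
  then have "deriv (\<lambda>s. zeta_reg s / (s - 1)) w =
      (deriv zeta_reg w * (w - 1) - zeta_reg w) / ((w - 1) * (w - 1))"
    by (rule DERIV_imp_deriv)
  with mangoldt_series_times_zeta[OF assms]
  have "mangoldt_series w * zeta_reg w / (w - 1) =
      - ((deriv zeta_reg w * (w - 1) - zeta_reg w) / ((w - 1) * (w - 1)))" by simp
  moreover have "x = z / u - d" if "x / u = - ((d * u - z) / (u * u))" "u \<noteq> 0" for x d z u :: complex
    using that by (simp add: field_simps)
  ultimately show ?thesis using w by blast
qed

section \<open>Non-vanishing of zeta on \<open>Re s \<ge> 1\<close>\<close>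

lemma mangoldt_series_limit:
  assumes "Re a \<ge> 1"
  obtains m :: nat where "m = 0 \<longleftrightarrow> zeta_reg a \<noteq> 0"
    "((\<lambda>e. of_real e * mangoldt_series (a + of_real e)) \<longlongrightarrow> (if a = 1 then 1 else 0) - of_nat m) (at_right 0)"
proof -
  let ?S = "{s. Re s > 0}"
  have "connected ?S" by (intro convex_connected convex_halfspace_Re_gt)
  moreover have "\<exists>w\<in>?S. zeta_reg w \<noteq> 0" by (intro bexI[of _ 1]) auto
  moreover have "a \<in> ?S" using assms by simp
  \<comment> \<open>With k the order of the zero at a, the logarithmic derivative of
    \<open>zeta_reg\<close> is k / (w - a) plus a holomorphic part. Multiplying by e = w - a and
    letting e tend to 0 isolates -k, together with 1 from the pole when a = 1.\<close>
  ultimately obtain k g r where kgr: "if zeta_reg a = 0 then k > 0 else k = (0::int)"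
      "r > 0" "cball a r \<subseteq> ?S" "g holomorphic_on cball a r"
      "\<And>w. w \<in> cball a r \<Longrightarrow> zeta_reg w = g w * (w - a) ^ nat k" "\<And>w. w \<in> cball a r \<Longrightarrow> g w \<noteq> 0"
    using zorder_exist_zero[OF zeta_reg_holomorphic open_Re_gt, of a] by blast
  define m where "m = nat k"
  have hol: "g holomorphic_on ball a r"
    using kgr(4) ball_subset_cball by (rule holomorphic_on_subset)
  have eq: "of_real e * mangoldt_series (a + of_real e) =
      of_real e / (a + of_real e - 1) - of_real e * (deriv g (a + of_real e) / g (a + of_real e)) - of_nat m"
    if e: "0 < e" "e < r" for e
  proof -
    define w where "w = a + of_real e"
    have wb: "w \<in> ball a r" using e by (simp add: w_def dist_norm)
    have g0: "g w \<noteq> 0" using kgr(6) wb by simp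
    have e0: "w - a = of_real e" "w - a \<noteq> 0" using e by (auto simp: w_def)
    have dg: "(g has_field_derivative deriv g w) (at w)"
      using holomorphic_derivI[OF hol open_ball wb] .
    have "((\<lambda>w. g w * (w - a) ^ m) has_field_derivative
        (deriv g w * (w - a) ^ m + of_nat m * (w - a) ^ (m - 1) * g w)) (at w)"
      by (auto intro!: derivative_eq_intros dg)
    then have "(zeta_reg has_field_derivative
        (deriv g w * (w - a) ^ m + of_nat m * (w - a) ^ (m - 1) * g w)) (at w)"
      by (rule has_field_derivative_transform_within_open[OF _ open_ball wb])
         (use kgr(5) m_def in auto)
    then have d: "deriv zeta_reg w = deriv g w * (w - a) ^ m + of_nat m * (w - a) ^ (m - 1) * g w"
      by (rule DERIV_imp_deriv)
    have z: "zeta_reg w = g w * (w - a) ^ m" using kgr(5)[of w] wb by (simp add: m_def)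
    have pm: "(w - a) * (of_nat m * (w - a) ^ (m - 1)) = of_nat m * (w - a) ^ m"
      by (cases m) auto
    have "Re w > 1" using assms e by (simp add: w_def)
    then have w1: "w \<noteq> 1" by auto
    have "(w - a) * mangoldt_series w * zeta_reg w = (w - a) * (zeta_reg w / (w - 1) - deriv zeta_reg w)"
      using mangoldt_series_eq[OF \<open>Re w > 1\<close>] by (simp add: mult.assoc)
    also have "\<dots> = (w - a) * (zeta_reg w / (w - 1)) - (w - a) * deriv g w * (w - a) ^ m
        - ((w - a) * (of_nat m * (w - a) ^ (m - 1))) * g w"
      unfolding d by (simp add: algebra_simps)
    also have "\<dots> = ((w - a) / (w - 1) - (w - a) * (deriv g w / g w) - of_nat m) * zeta_reg w"
      unfolding pm z using g0 w1 by (simp add: field_simps)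
    finally have "(w - a) * mangoldt_series w = (w - a) / (w - 1) - (w - a) * (deriv g w / g w) - of_nat m"
      using g0 e0(2) z by simp
    then show ?thesis unfolding e0(1) w_def by simp
  qed
  have ta: "((\<lambda>e. a + of_real e) \<longlongrightarrow> a) (at_right 0)"
    by (auto intro!: tendsto_eq_intros)
  have "isCont g a" "isCont (deriv g) a"
    using hol holomorphic_deriv[OF hol open_ball] kgr(2)
    by (auto intro!: continuous_on_interior[of "ball a r"] holomorphic_on_imp_continuous_on)
  then have "((\<lambda>e. of_real e * (deriv g (a + of_real e) / g (a + of_real e))) \<longlongrightarrow> of_real 0 * (deriv g a / g a)) (at_right 0)"
    by (intro tendsto_mult tendsto_divide tendsto_of_real tendsto_ident_at isCont_tendsto_compose[OF _ ta])
       (use kgr(2,6) in auto)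
  moreover have "((\<lambda>e. of_real e / (a + of_real e - 1)) \<longlongrightarrow> (if a = 1 then 1 else 0)) (at_right 0)"
  proof (cases "a = 1")
    case True
    have "\<forall>\<^sub>F e in at_right (0::real). of_real e / (a + of_real e - 1) = (1 :: complex)"
      using eventually_at_right_less[of "0::real"] by eventually_elim (simp add: True)
    then show ?thesis using True by (simp add: tendsto_eventually)
  next
    case False
    have "((\<lambda>e. of_real e / (a + of_real e - 1)) \<longlongrightarrow> of_real 0 / (a - 1)) (at_right 0)"
      by (intro tendsto_divide tendsto_of_real tendsto_ident_at tendsto_diff ta tendsto_const) (use False in auto)
    then show ?thesis using False by simp
  qed
  ultimately have "((\<lambda>e. of_real e / (a + of_real e - 1)
      - of_real e * (deriv g (a + of_real e) / g (a + of_real e)) - of_nat m) \<longlongrightarrow>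
      (if a = 1 then 1 else 0) - of_real 0 * (deriv g a / g a) - of_nat m) (at_right 0)"
    by (intro tendsto_diff tendsto_const)
  moreover have "\<forall>\<^sub>F e in at_right 0. of_real e / (a + of_real e - 1)
      - of_real e * (deriv g (a + of_real e) / g (a + of_real e)) - of_nat m
      = of_real e * mangoldt_series (a + of_real e)"
    using eventually_at_right_real[OF kgr(2)] by eventually_elim (use eq in auto)
  ultimately have "((\<lambda>e. of_real e * mangoldt_series (a + of_real e)) \<longlongrightarrow>
      (if a = 1 then 1 else 0) - of_nat m) (at_right 0)"
    by (simp add: tendsto_cong)
  then show ?thesis using kgr(1) by (intro that[of m]) (auto simp: m_def split: if_splits)
qed

lemma mangoldt_series_limit_neq_1:
  assumes "Re a \<ge> 1" "a \<noteq> 1"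
  obtains m :: nat where "m = 0 \<longleftrightarrow> zeta_reg a \<noteq> 0"
    "((\<lambda>e. of_real e * mangoldt_series (a + of_real e)) \<longlongrightarrow> - of_nat m) (at_right 0)"
proof -
  obtain m :: nat where m: "m = 0 \<longleftrightarrow> zeta_reg a \<noteq> 0"
    "((\<lambda>e. of_real e * mangoldt_series (a + of_real e)) \<longlongrightarrow> (if a = 1 then 1 else 0) - of_nat m) (at_right 0)"
    by (rule mangoldt_series_limit[OF assms(1)])
  show ?thesis by (rule that[OF m(1)]) (use m(2) assms(2) in simp)
qed

lemma of_nat_powr_minus:
  "of_nat n powr (-s) = of_real (real n powr (- Re s)) * cis (- Im s * ln (real n))"
proof (cases "n = 0")
  case False
  then show ?thesis
    by (simp add: powr_def Ln_of_nat exp_eq_polar Re_exp)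
qed auto

lemma Re_mangoldt_series_sums:
  assumes "Re s > 1"
  shows "(\<lambda>n. mangoldt n * real n powr (- Re s) * cos (Im s * ln (real n))) sums Re (mangoldt_series s)"
proof -
  have "Re (mangoldt n * of_nat n powr (-s)) = mangoldt n * real n powr (- Re s) * cos (Im s * ln (real n))" for n
    by (simp add: of_nat_powr_minus)
  then show ?thesis using sums_Re[OF mangoldt_series_sums[OF assms]] by (simp only:)
qed

text \<open>On the line Re a = 1 this is Mertens' argument: 3 + 4 cos x + cos (2 x) = 2 (1 + cos
  x)^2 \<ge> 0 and \<Lambda> \<ge> 0, so the limits at 1, a and 1 + 2 i t satisfy 3 - 4 m - m2 \<ge>
  0, which forces the order m of the zero to be 0.\<close>

lemma zeta_reg_nonzero:
  assumes "Re a \<ge> 1"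
  shows "zeta_reg a \<noteq> 0"
proof (cases "a = 1")
  case a1: False
  obtain m :: nat where m: "m = 0 \<longleftrightarrow> zeta_reg a \<noteq> 0"
    "((\<lambda>e. of_real e * mangoldt_series (a + of_real e)) \<longlongrightarrow> - of_nat m) (at_right 0)"
    by (rule mangoldt_series_limit_neq_1[OF assms a1])
  show ?thesis
  proof (cases "Re a > 1")
    case True
    \<comment> \<open>To the right of the line the series stays bounded near a, so the limit
      computing -m is 0.\<close>
    define B where "B = (\<Sum>n. mangoldt n * real n powr (- Re a))"
    have "\<forall>\<^sub>F e in at_right 0. norm (of_real e * mangoldt_series (a + of_real e)) \<le> e * B"
      using eventually_at_right_less[of "0::real"]
    proof eventually_elim
      case (elim e)
      then have R: "Re (a + of_real e) > 1" using True by simp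
      have "norm (mangoldt_series (a + of_real e)) \<le> B"
        unfolding mangoldt_series_def B_def
      proof (rule norm_suminf_le)
        show "summable (\<lambda>n. mangoldt n * real n powr - Re a)" by (rule summable_mangoldt_powr[OF True])
        fix n :: nat
        show "norm (mangoldt n * of_nat n powr - (a + of_real e) :: complex) \<le> mangoldt n * real n powr - Re a"
          using elim by (cases "n = 0") (auto simp: norm_mult norm_of_nat_powr intro!: mult_left_mono powr_mono mangoldt_nonneg)
      qed
      then show ?case using elim by (simp add: norm_mult)
    qed
    moreover have "((\<lambda>e. e * B) \<longlongrightarrow> 0) (at_right 0)"
      by (auto intro!: tendsto_eq_intros)
    ultimately have "((\<lambda>e. of_real e * mangoldt_series (a + of_real e)) \<longlongrightarrow> 0) (at_right 0)"
      by (rule Lim_null_comparison)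
    from tendsto_unique[OF _ m(2) this] have "m = 0" by simp
    then show ?thesis using m by simp
  next
    case False
    define t where "t = Im a"
    have a: "a = Complex 1 t" using False assms by (simp add: t_def complex_eq_iff)
    have t: "t \<noteq> 0" using a a1 by (auto simp: complex_eq_iff)
    have m0: "((\<lambda>e. of_real e * mangoldt_series (1 + of_real e)) \<longlongrightarrow> 1) (at_right 0)"
      by (rule mangoldt_series_limit[of 1]) auto
    have "Complex 1 (2 * t) \<noteq> 1" using t by (auto simp: complex_eq_iff)
    then obtain m2 :: nat where m2:
      "((\<lambda>e. of_real e * mangoldt_series (Complex 1 (2 * t) + of_real e)) \<longlongrightarrow> - of_nat m2) (at_right 0)"
      by (rule mangoldt_series_limit_neq_1[rotated]) auto
    let ?F = "\<lambda>e. 3 * (of_real e * mangoldt_series (1 + of_real e)) +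
        4 * (of_real e * mangoldt_series (a + of_real e)) +
        of_real e * mangoldt_series (Complex 1 (2 * t) + of_real e)"
    have "((\<lambda>e. Re (?F e)) \<longlongrightarrow> Re (3 * 1 + 4 * (- of_nat m) + (- of_nat m2))) (at_right 0)"
      by (intro tendsto_Re tendsto_add tendsto_mult tendsto_const m(2) m0 m2)
    moreover have "\<forall>\<^sub>F e in at_right 0. Re (?F e) \<ge> 0"
      using eventually_at_right_less[of "0::real"]
    proof eventually_elim
      case (elim e)
      let ?c = "\<lambda>n. mangoldt n * real n powr (- (1 + e))"
      have "(\<lambda>n. ?c n * cos (0 * ln (real n))) sums Re (mangoldt_series (1 + of_real e))"
        "(\<lambda>n. ?c n * cos (t * ln (real n))) sums Re (mangoldt_series (a + of_real e))"
        "(\<lambda>n. ?c n * cos (2 * t * ln (real n))) sums Re (mangoldt_series (Complex 1 (2 * t) + of_real e))"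
        using Re_mangoldt_series_sums[of "1 + of_real e"] Re_mangoldt_series_sums[of "a + of_real e"]
          Re_mangoldt_series_sums[of "Complex 1 (2 * t) + of_real e"] elim a by simp_all
      then have "(\<lambda>n. 3 * (?c n * cos (0 * ln (real n))) + 4 * (?c n * cos (t * ln (real n)))
          + ?c n * cos (2 * t * ln (real n))) sums
          (3 * Re (mangoldt_series (1 + of_real e)) + 4 * Re (mangoldt_series (a + of_real e))
          + Re (mangoldt_series (Complex 1 (2 * t) + of_real e)))" (is "?f sums ?s")
        by (intro sums_add sums_mult)
      moreover have "?f n \<ge> 0" for n
      proof -
        have cd: "cos (2 * t * ln (real n)) = 2 * (cos (t * ln (real n)))\<^sup>2 - 1"
          using cos_double_cos[of "t * ln (real n)"] by (simp add: mult.assoc)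
        have "?f n = ?c n * (2 * (1 + cos (t * ln (real n)))\<^sup>2)"
          unfolding cd by (simp add: power2_eq_square algebra_simps)
        then show ?thesis by (simp add: mangoldt_nonneg)
      qed
      ultimately have "?s \<ge> 0" using sums_le[of "\<lambda>_. 0" ?f 0 ?s] by simp
      then have "e * ?s \<ge> 0" using elim by simp
      then show ?case by (simp add: algebra_simps)
    qed
    ultimately have "Re (3 * 1 + 4 * (- of_nat m) + (- of_nat m2)) \<ge> 0"
      by (intro tendsto_lowerbound) auto
    then have "real (4 * m + m2) \<le> 3" by simp
    then have "m = 0" by linarith
    then show ?thesis using m by simp
  qed
qed auto

text \<open>This is -zeta'/zeta - zeta: both parts have a simple pole of residue 1 at s = 1, and
  what remains is a difference quotient of \<open>zeta_reg\<close>, completed at 1 by the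
  derivative. Writing \<open>zeta_reg 1\<close> for 1 puts it in the shape of the removable
  singularity lemma.\<close>

definition zeta_remainder :: "complex \<Rightarrow> complex" where
  "zeta_remainder s = - (deriv zeta_reg s / zeta_reg s)
     - (if s = 1 then deriv zeta_reg 1 else (zeta_reg s - zeta_reg 1) / (s - 1))"

definition zeta_domain :: "complex set" where
  "zeta_domain = {s. Re s > 0 \<and> zeta_reg s \<noteq> 0}"

lemma open_zeta_domain: "open zeta_domain"
proof -
  have "continuous_on {s. Re s > 0} zeta_reg"
    by (rule holomorphic_on_imp_continuous_on[OF zeta_reg_holomorphic])
  then have "open ({s. Re s > 0} \<inter> zeta_reg -` (- {0}))"
    by (rule continuous_open_preimage) (auto simp: open_Re_gt)
  also have "\<dots> = zeta_domain" by (auto simp: zeta_domain_def)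
  finally show ?thesis .
qed

lemma zeta_remainder_holomorphic: "zeta_remainder holomorphic_on zeta_domain"
proof -
  have sub: "zeta_domain \<subseteq> {s. Re s > 0}" by (auto simp: zeta_domain_def)
  have "(\<lambda>s. if s = 1 then deriv zeta_reg 1 else (zeta_reg s - zeta_reg 1) / (s - 1)) holomorphic_on zeta_domain"
    by (rule holomorphic_on_subset[OF pole_lemma_open[OF zeta_reg_holomorphic open_Re_gt] sub])
  moreover have "deriv zeta_reg holomorphic_on zeta_domain" "zeta_reg holomorphic_on zeta_domain"
    by (rule holomorphic_on_subset[OF _ sub], intro holomorphic_deriv zeta_reg_holomorphic open_Re_gt)+
  ultimately show ?thesis unfolding zeta_remainder_def
    by (intro holomorphic_on_diff holomorphic_on_minus holomorphic_on_divide) (auto simp: zeta_domain_def)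
qed

lemma zeta_remainder_sums:
  assumes "Re s > 1"
  shows "(\<lambda>n. of_real (mangoldt n - 1) * of_nat n powr (-s)) sums zeta_remainder s"
proof -
  have s1: "s \<noteq> 1" "s - 1 \<noteq> 0" using assms by auto
  have z: "zeta_reg s \<noteq> 0" using assms by (intro zeta_reg_nonzero) auto
  have "mangoldt_series s = 1 / (s - 1) - deriv zeta_reg s / zeta_reg s"
  proof -
    have "M = 1 / u - d / z" if "M * z = z / u - d" "u \<noteq> 0" "z \<noteq> 0" for M d z u :: complex
      using that by (simp add: field_simps)
    then show ?thesis using mangoldt_series_eq[OF assms] z s1(2) by blast
  qed
  then have "mangoldt_series s - zeta_reg s / (s - 1) = zeta_remainder s"
    using s1 by (simp add: zeta_remainder_def diff_divide_distrib)
  then show ?thesis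
    using sums_diff[OF mangoldt_series_sums[OF assms] zeta_sums[OF assms]] by (simp add: algebra_simps)
qed

section \<open>Primes in short multiplicative intervals\<close>

definition fejer :: "real \<Rightarrow> real \<Rightarrow> real" where
  "fejer T v = (if v = 0 then T / 2 else (1 - cos (T * v)) / (T * v\<^sup>2))"

text \<open>Being the cosine transform of a triangle supported on [0, T], the kernel sees the
  Dirichlet series only on a bounded vertical segment, where continuity up to Re s = 1 is
  uniform.\<close>

lemma fejer_has_integral:
  assumes "T > 0"
  shows "((\<lambda>t. (1 - t / T) * cos (t * v)) has_integral fejer T v) {0..T}"
proof (cases "v = 0")
  case True
  have "((\<lambda>t. 1 - t / T) has_integral (T - T\<^sup>2 / (2 * T)) - (0 - 0\<^sup>2 / (2 * T))) {0..T}"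
    using assms by (intro fundamental_theorem_of_calculus)
      (auto intro!: derivative_eq_intros simp flip: has_real_derivative_iff_has_vector_derivative)
  then show ?thesis using True assms by (simp add: fejer_def power2_eq_square)
next
  case False
  let ?F = "\<lambda>t. (1 - t / T) * sin (t * v) / v - cos (t * v) / (T * v\<^sup>2)"
  have "((\<lambda>t. (1 - t / T) * cos (t * v)) has_integral ?F T - ?F 0) {0..T}"
    using assms False by (intro fundamental_theorem_of_calculus)
      (auto intro!: derivative_eq_intros simp: field_simps power2_eq_square
            simp flip: has_real_derivative_iff_has_vector_derivative)
  then show ?thesis using False assms by (simp add: fejer_def diff_divide_distrib)
qed

lemma fejer_nonneg: "T > 0 \<Longrightarrow> fejer T v \<ge> 0"
  by (simp add: fejer_def)

lemma fejer_le_half: 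
  assumes "T > 0"
  shows "fejer T v \<le> T / 2"
proof -
  have "fejer T v \<le> fejer T 0"
    by (rule has_integral_le[OF fejer_has_integral[OF assms] fejer_has_integral[OF assms]])
       (use assms in \<open>auto intro!: mult_left_le\<close>)
  then show ?thesis by (simp add: fejer_def)
qed

text \<open>For t \<le> T the angle t v is at most 1 < pi/3 in absolute value, so every cosine in
  the integral is at least 1/2, and the value is at least half of
  \<open>fejer T 0 = T / 2\<close>.\<close>

lemma fejer_ge:
  assumes "T > 0" "\<bar>v\<bar> \<le> 1 / T"
  shows "fejer T v \<ge> T / 4"
proof -
  have "((\<lambda>t. (1 - t / T) * cos (t * 0) * (1 / 2)) has_integral fejer T 0 * (1 / 2)) {0..T}"
    by (rule has_integral_mult_left[OF fejer_has_integral[OF assms(1)]])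
  then have "fejer T 0 * (1 / 2) \<le> fejer T v"
  proof (rule has_integral_le[OF _ fejer_has_integral[OF assms(1)]])
    fix t assume t: "t \<in> {0..T}"
    have "\<bar>t * v\<bar> \<le> T * (1 / T)"
      unfolding abs_mult using t assms by (intro mult_mono) auto
    then have "\<bar>t * v\<bar> \<le> pi / 3" using assms pi_gt3 by simp
    then have "cos (pi / 3) \<le> cos \<bar>t * v\<bar>"
      by (intro cos_monotone_0_pi_le) auto
    then have "1 / 2 \<le> cos (t * v)" by (simp add: cos_60)
    then show "(1 - t / T) * cos (t * 0) * (1 / 2) \<le> (1 - t / T) * cos (t * v)"
      using t assms by (simp only: mult.assoc) (intro mult_left_mono, auto)
  qed
  then show ?thesis by (simp add: fejer_def)
qed

lemma fejer_le_square:
  assumes "T > 0" "v \<noteq> 0"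
  shows "fejer T v \<le> 2 / (T * v\<^sup>2)"
proof -
  have "1 - cos (T * v) \<le> 2" using cos_ge_minus_one[of "T * v"] by linarith
  then show ?thesis using assms by (auto simp: fejer_def intro!: divide_right_mono)
qed

text \<open>The Cauchy kernel merges the bounds T/2 near 0 and 2 / (T v^2) away from 0. It is easy
  to sum because its antiderivative is arctan, and by the next lemma it varies by at most a factor 3
  over unit shifts.\<close>

lemma fejer_le_cauchy:
  assumes "T > 0"
  shows "fejer T v \<le> (T / 2 + 2 / T) * (1 / (1 + v\<^sup>2))"
proof -
  have "fejer T v * v\<^sup>2 \<le> 2 / T"
    using fejer_le_square[OF assms, of v] assms by (cases "v = 0") (auto simp: field_simps)
  then have "fejer T v * (1 + v\<^sup>2) \<le> T / 2 + 2 / T"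
    using fejer_le_half[OF assms, of v] by (simp add: algebra_simps)
  moreover have "1 + v\<^sup>2 > 0" by (simp add: add_pos_nonneg)
  ultimately show ?thesis by (simp add: pos_le_divide_eq)
qed

lemma cauchy_shift_le:
  fixes v d :: real
  assumes "\<bar>d\<bar> \<le> 1"
  shows "1 / (1 + v\<^sup>2) \<le> 3 * (1 / (1 + (v + d)\<^sup>2))"
proof -
  have "d\<^sup>2 \<le> 1" using assms by (simp add: abs_square_le_1)
  moreover have "(v + d)\<^sup>2 \<le> 2 * v\<^sup>2 + 2 * d\<^sup>2"
    using zero_le_power2[of "v - d"] by (simp add: power2_eq_square algebra_simps)
  moreover have "1 + a \<le> 3 * (1 + x)" if "y \<le> 1" "a \<le> 2 * x + 2 * y" "0 \<le> x" for a x y :: real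
    using that by simp
  ultimately have "1 + (v + d)\<^sup>2 \<le> 3 * (1 + v\<^sup>2)" using zero_le_power2[of v] by blast
  moreover have "1 + (v + d)\<^sup>2 > 0" "1 + v\<^sup>2 > 0" by (simp_all add: add_pos_nonneg)
  ultimately show ?thesis by (simp add: field_simps)
qed

text \<open>A single Fejer kernel vanishes at some points, but two shifted copies have no common zero.\<close>

lemma cauchy_le_fejer:
  obtains c where "c > 0" "\<And>v. c * (1 / (1 + v\<^sup>2)) \<le> fejer 1 v + fejer 1 (v + 1)"
proof
  \<comment> \<open>The numerator bounds (1 - cos v) + (1 - cos (v + 1)) from below, since cos v +
    cos (v + 1) = 2 cos (v + 1/2) cos (1/2). The 3 pays for replacing the Cauchy kernel at v + 1 by
    the one at v.\<close>
  let ?c = "(2 - 2 * cos (1 / 2)) / 3 :: real"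
  have "cos (1 / 2) < cos (0::real)" by (intro cos_monotone_0_pi) (use pi_gt3 in auto)
  then show "?c > 0" by simp
  fix v :: real
  have f: "fejer 1 v \<ge> (1 - cos v) * (1 / (1 + v\<^sup>2))" for v
  proof (cases "v = 0")
    case False
    then have "1 / (1 + v\<^sup>2) \<le> 1 / v\<^sup>2" by (intro divide_left_mono) (auto simp: add_pos_nonneg)
    then have "(1 - cos v) * (1 / (1 + v\<^sup>2)) \<le> (1 - cos v) * (1 / v\<^sup>2)"
      by (intro mult_left_mono) auto
    then show ?thesis using False by (simp add: fejer_def)
  qed (simp add: fejer_def)
  have "(1 / 3) * a \<le> b" if "a \<le> 3 * b" for a b :: real using that by simp
  from this[OF cauchy_shift_le[of 1 v]]
  have q: "(1 / 3) * (1 / (1 + v\<^sup>2)) \<le> 1 / (1 + (v + 1)\<^sup>2)" by simp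
  have "(1 / 3) * a \<le> a" if "a \<ge> 0" for a :: real using that by simp
  from this[of "1 / (1 + v\<^sup>2)"]
  have q': "(1 / 3) * (1 / (1 + v\<^sup>2)) \<le> 1 / (1 + v\<^sup>2)" by (simp add: add_nonneg_nonneg)
  have "cos v + cos (v + 1) = 2 * cos (v + 1 / 2) * cos (1 / 2)"
    using cos_plus_cos[of "v + 1" v] by (simp add: algebra_simps add_divide_distrib)
  also have "\<dots> \<le> 2 * 1 * cos (1 / 2)"
    by (intro mult_mono mult_left_mono) (use pi_gt3 in \<open>auto intro!: cos_ge_zero\<close>)
  finally have c: "cos v + cos (v + 1) \<le> 2 * cos (1 / 2)" by simp
  have "?c * (1 / (1 + v\<^sup>2)) \<le> ((1 - cos v) + (1 - cos (v + 1))) * ((1 / 3) * (1 / (1 + v\<^sup>2)))"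
    unfolding mult.assoc[symmetric] times_divide_eq_right mult_1_right
    using c by (intro divide_right_mono) (auto simp: add_nonneg_nonneg field_simps)
  also have "\<dots> = (1 - cos v) * ((1 / 3) * (1 / (1 + v\<^sup>2))) + (1 - cos (v + 1)) * ((1 / 3) * (1 / (1 + v\<^sup>2)))"
    by (simp only: distrib_right)
  also have "\<dots> \<le> (1 - cos v) * (1 / (1 + v\<^sup>2)) + (1 - cos (v + 1)) * (1 / (1 + (v + 1)\<^sup>2))"
    using q q' by (intro add_mono mult_left_mono) auto
  also have "\<dots> \<le> fejer 1 v + fejer 1 (v + 1)" by (intro add_mono f)
  finally show "?c * (1 / (1 + v\<^sup>2)) \<le> fejer 1 v + fejer 1 (v + 1)" .
qed

section \<open>Smoothed sums and their continuation to \<open>Re s = 1\<close>\<close>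

lemma fejer_sums:
  fixes c L :: "nat \<Rightarrow> real"
  assumes T: "T > 0" and c: "summable (\<lambda>n. \<bar>c n\<bar>)"
    and f: "\<And>t. t \<in> {0..T} \<Longrightarrow> (\<lambda>n. c n * cos (t * (L n - u))) sums f t"
  shows "(\<lambda>n. c n * fejer T (L n - u)) sums integral {0..T} (\<lambda>t. (1 - t / T) * f t)"
proof -
  let ?g = "\<lambda>n t. (1 - t / T) * (c n * cos (t * (L n - u)))"
  \<comment> \<open>The triangle weight and the cosine are bounded by 1, so the absolutely summable
    coefficients justify exchanging sum and integral.\<close>
  have "uniform_limit {0..T} (\<lambda>N t. \<Sum>n<N. ?g n t) (\<lambda>t. \<Sum>n. ?g n t) sequentially"
  proof (rule Weierstrass_m_test[OF _ c])
    fix n t assume t: "t \<in> {0..T}"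
    have "\<bar>1 - t / T\<bar> * (\<bar>c n\<bar> * \<bar>cos (t * (L n - u))\<bar>) \<le> 1 * (\<bar>c n\<bar> * 1)"
      using t T by (intro mult_mono) auto
    then show "norm (?g n t) \<le> \<bar>c n\<bar>" by (simp add: abs_mult)
  qed
  then obtain I J where IJ: "\<And>N. ((\<lambda>t. \<Sum>n<N. ?g n t) has_integral I N) {0..T}"
      "((\<lambda>t. \<Sum>n. ?g n t) has_integral J) {0..T}" "I \<longlonglongrightarrow> J"
    by (rule uniform_limit_integral) (use T in \<open>auto intro!: continuous_intros\<close>)
  have "I N = (\<Sum>n<N. c n * fejer T (L n - u))" for N
  proof -
    have "((\<lambda>t. c n * ((1 - t / T) * cos (t * (L n - u)))) has_integral c n * fejer T (L n - u)) {0..T}" for n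
      by (rule has_integral_mult_right[OF fejer_has_integral[OF T]])
    then have "((\<lambda>t. \<Sum>n<N. c n * ((1 - t / T) * cos (t * (L n - u)))) has_integral
        (\<Sum>n<N. c n * fejer T (L n - u))) {0..T}"
      by (intro has_integral_sum) auto
    then show ?thesis using IJ(1)[of N] by (auto simp: algebra_simps intro: has_integral_unique)
  qed
  moreover have "J = integral {0..T} (\<lambda>t. (1 - t / T) * f t)"
  proof -
    have "(\<Sum>n. ?g n t) = (1 - t / T) * f t" if "t \<in> {0..T}" for t
      using sums_mult[OF f[OF that], of "1 - t / T"] by (simp add: sums_iff)
    then have "((\<lambda>t. (1 - t / T) * f t) has_integral J) {0..T}"
      using IJ(2) by (subst has_integral_cong[where g = "\<lambda>t. \<Sum>n. ?g n t"]) auto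
    then show ?thesis by (simp add: integral_unique)
  qed
  ultimately show ?thesis using IJ(3) unfolding sums_def by presburger
qed

text \<open>The smoothed discrepancy between \<Lambda> and 1 around exp u, given as an integral
  rather than a series so that it has a meaning at \<sigma> = 1.\<close>

definition fejer_remainder :: "real \<Rightarrow> real \<Rightarrow> real \<Rightarrow> real" where
  "fejer_remainder T \<sigma> u =
     integral {0..T} (\<lambda>t. (1 - t / T) * Re (cis (t * u) * zeta_remainder (Complex \<sigma> t)))"

lemma mangoldt_fejer_sums:
  assumes "T > 0" "\<sigma> > 1"
  shows "(\<lambda>n. (mangoldt n - 1) * real n powr (-\<sigma>) * fejer T (ln (real n) - u)) sums fejer_remainder T \<sigma> u"
  unfolding fejer_remainder_def
proof (rule fejer_sums[OF assms(1)])
  have "summable (\<lambda>n. mangoldt n * real n powr (-\<sigma>) + real n powr (-\<sigma>))"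
    using assms by (intro summable_add summable_mangoldt_powr) (auto simp: summable_real_powr_iff)
  then show "summable (\<lambda>n. \<bar>(mangoldt n - 1) * real n powr (-\<sigma>)\<bar>)"
  proof (rule summable_comparison_test'[where N = 0])
    fix n :: nat
    have "\<bar>mangoldt n - 1\<bar> \<le> mangoldt n + (1 :: real)" using mangoldt_nonneg[of n] by linarith
    then show "norm \<bar>(mangoldt n - 1) * real n powr (-\<sigma>)\<bar> \<le> mangoldt n * real n powr (-\<sigma>) + real n powr (-\<sigma>)"
      using mult_right_mono[of "\<bar>mangoldt n - 1\<bar>" "mangoldt n + 1" "real n powr (-\<sigma>)"]
      unfolding real_norm_def abs_idempotent abs_mult distrib_right by simp
  qed
next
  fix t
  have "(\<lambda>n. Re (cis (t * u) * (of_real (mangoldt n - 1) * of_nat n powr (- Complex \<sigma> t)))) sums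
      Re (cis (t * u) * zeta_remainder (Complex \<sigma> t))"
    using assms by (intro sums_Re sums_mult zeta_remainder_sums) simp
  moreover have "Re (cis (t * u) * (of_real (mangoldt n - 1) * of_nat n powr (- Complex \<sigma> t))) =
      (mangoldt n - 1) * real n powr (-\<sigma>) * cos (t * (ln (real n) - u))" for n
  proof -
    have "cis (t * u) * (of_real (mangoldt n - 1) * of_nat n powr (- Complex \<sigma> t)) =
        of_real ((mangoldt n - 1) * real n powr (-\<sigma>)) * (cis (t * u) * cis (- t * ln (real n)))"
      unfolding of_nat_powr_minus by simp
    also have "cis (t * u) * cis (- t * ln (real n)) = cis (- (t * (ln (real n) - u)))"
      unfolding cis_mult by (simp add: algebra_simps)
    finally have e: "cis (t * u) * (of_real (mangoldt n - 1) * of_nat n powr (- Complex \<sigma> t)) =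
        of_real ((mangoldt n - 1) * real n powr (-\<sigma>)) * cis (- (t * (ln (real n) - u)))" .
    show ?thesis unfolding e by simp
  qed
  ultimately show "(\<lambda>n. (mangoldt n - 1) * real n powr (-\<sigma>) * cos (t * (ln (real n) - u))) sums
      Re (cis (t * u) * zeta_remainder (Complex \<sigma> t))" by (simp only:)
qed

lemma Complex_in_zeta_domain: "\<sigma> \<ge> 1 \<Longrightarrow> Complex \<sigma> t \<in> zeta_domain"
  using zeta_reg_nonzero[of "Complex \<sigma> t"] by (simp add: zeta_domain_def)

text \<open>Non-vanishing enters here: it makes \<open>zeta_remainder\<close> continuous on the
  closed rectangle [1, 2] x [0, T], including its left edge.\<close>

lemma fejer_remainder_tendsto:
  assumes "T > 0"
  shows "((\<lambda>\<sigma>. fejer_remainder T \<sigma> u) \<longlongrightarrow> fejer_remainder T 1 u) (at_right 1)"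
proof -
  have c: "continuous_on ({1..2} \<times> {0..T}) (\<lambda>x. zeta_remainder (Complex (fst x) (snd x)))"
    by (rule continuous_on_compose2[OF holomorphic_on_imp_continuous_on[OF zeta_remainder_holomorphic]])
       (auto simp: Complex_in_zeta_domain intro: continuous_intros
             intro!: continuous_on_Complex)
  have "continuous_on {1..2} (\<lambda>\<sigma>. fejer_remainder T \<sigma> u)"
    unfolding fejer_remainder_def cbox_interval[symmetric]
    by (rule integral_continuous_on_param)
       (use assms in \<open>auto simp: split_beta intro!: continuous_intros continuous_on_Re c\<close>)
  then have "((\<lambda>\<sigma>. fejer_remainder T \<sigma> u) \<longlongrightarrow> fejer_remainder T 1 u) (at 1 within {1..2})"
    by (auto simp: continuous_on_def)
  then show ?thesis
    using at_within_Icc_at_right[of 1 "2::real"] by simp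
qed

text \<open>A Riemann-Lebesgue statement for differentiable amplitudes: one integration by parts
  gains a factor 1/u.\<close>

lemma oscillatory_integral_tendsto_0:
  fixes g g' :: "real \<Rightarrow> complex"
  assumes T: "T > 0"
    and g: "\<And>t. t \<in> {0..T} \<Longrightarrow> (g has_vector_derivative g' t) (at t within {0..T})"
    and g': "continuous_on {0..T} g'"
  shows "((\<lambda>u. integral {0..T} (\<lambda>t. cis (t * u) * g t)) \<longlongrightarrow> 0) at_top"
proof -
  obtain B where B: "\<And>t. t \<in> {0..T} \<Longrightarrow> norm (g' t) \<le> B"
    using compact_imp_bounded[OF compact_continuous_image[OF g' compact_Icc]]
    unfolding bounded_iff by blast
  have cg: "continuous_on {0..T} g"
    using g by (meson continuous_on_vector_derivative)
  define C where "C = norm (g T) + norm (g 0) + B * T"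
  have bound: "norm (integral {0..T} (\<lambda>t. cis (t * u) * g t)) \<le> C / u" if u: "u > 0" for u
  proof -
    let ?H = "\<lambda>t. cis (t * u) * g t / (\<i> * of_real u)"
    have cis': "((\<lambda>t. cis (t * u)) has_vector_derivative (\<i> * of_real u * cis (t * u))) (at t within {0..T})" for t
    proof -
      have "((\<lambda>t. cis (t * u)) has_vector_derivative (u *\<^sub>R (\<i> * cis (t * u)))) (at t within {0..T})"
        unfolding has_vector_derivative_def
        by (rule has_derivative_eq_rhs[OF has_derivative_cis[OF has_derivative_mult_left[OF has_derivative_ident]]])
           (simp add: fun_eq_iff)
      then show ?thesis by (simp add: scaleR_conv_of_real mult_ac)
    qed
    have "((\<lambda>t. cis (t * u) * g t + cis (t * u) * g' t / (\<i> * of_real u)) has_integral (?H T - ?H 0)) {0..T}"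
    proof (rule fundamental_theorem_of_calculus)
      fix t assume t: "t \<in> {0..T}"
      have "(?H has_vector_derivative
          (cis (t * u) * g' t + (\<i> * of_real u * cis (t * u)) * g t) / (\<i> * of_real u)) (at t within {0..T})"
        by (intro has_vector_derivative_divide has_vector_derivative_mult cis' g[OF t])
      then show "(?H has_vector_derivative cis (t * u) * g t + cis (t * u) * g' t / (\<i> * of_real u)) (at t within {0..T})"
        using u by (simp add: add_divide_distrib add.commute)
    qed (use T in auto)
    then have 1: "integral {0..T} (\<lambda>t. cis (t * u) * g t + cis (t * u) * g' t / (\<i> * of_real u)) = ?H T - ?H 0"
      by (rule integral_unique)
    have i1: "(\<lambda>t. cis (t * u) * g t) integrable_on {0..T}"
      "(\<lambda>t. cis (t * u) * g' t / (\<i> * of_real u)) integrable_on {0..T}"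
      using u by (auto intro!: integrable_continuous_interval continuous_intros cg g')
    have "integral {0..T} (\<lambda>t. cis (t * u) * g t) = ?H T - ?H 0
        - integral {0..T} (\<lambda>t. cis (t * u) * g' t / (\<i> * of_real u))"
      using 1 unfolding integral_add[OF i1] by (simp add: algebra_simps)
    also have "norm \<dots> \<le> norm (?H T) + norm (?H 0)
        + norm (integral {0..T} (\<lambda>t. cis (t * u) * g' t / (\<i> * of_real u)))"
      using norm_triangle_ineq4[of "?H T - ?H 0"] norm_triangle_ineq4[of "?H T" "?H 0"]
      by (smt (verit, best))
    also have "norm (integral {0..T} (\<lambda>t. cis (t * u) * g' t / (\<i> * of_real u))) \<le> (B / u) * (T - 0)"
    proof (rule integral_bound)
      show "continuous_on {0..T} (\<lambda>t. cis (t * u) * g' t / (\<i> * of_real u))"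
        using u by (auto intro!: continuous_intros g')
      show "norm (cis (t * u) * g' t / (\<i> * of_real u)) \<le> B / u" if "t \<in> {0..T}" for t
        using B[OF that] u by (simp add: norm_mult norm_divide divide_right_mono)
    qed (use T in auto)
    finally show ?thesis
      using u by (simp add: C_def norm_mult norm_divide add_divide_distrib)
  qed
  have lim: "((\<lambda>u. C / u) \<longlongrightarrow> 0) at_top"
    by (rule tendsto_divide_0[OF tendsto_const filterlim_at_top_imp_at_infinity[OF filterlim_ident]])
  have "\<forall>\<^sub>F u in at_top. norm (integral {0..T} (\<lambda>t. cis (t * u) * g t)) \<le> C / u"
    using eventually_gt_at_top[of 0] by eventually_elim (rule bound)
  then show ?thesis using lim by (rule Lim_null_comparison)
qed

lemma fejer_remainder_tendsto_0:
  assumes T: "T > 0"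
  shows "((\<lambda>u. fejer_remainder T 1 u) \<longlongrightarrow> 0) at_top"
proof -
  let ?Z = "\<lambda>t. zeta_remainder (Complex 1 t)" and ?Z' = "\<lambda>t. deriv zeta_remainder (Complex 1 t)"
  let ?g = "\<lambda>t. of_real (1 - t / T) * ?Z t"
  let ?g' = "\<lambda>t. of_real (1 - t / T) * (\<i> * ?Z' t) + of_real (- 1 / T) * ?Z t"
  have cont: "continuous_on {0..T} ?Z" "continuous_on {0..T} ?Z'"
    by (rule continuous_on_compose2[OF holomorphic_on_imp_continuous_on[OF zeta_remainder_holomorphic]]
             continuous_on_compose2[OF holomorphic_on_imp_continuous_on[OF
               holomorphic_deriv[OF zeta_remainder_holomorphic open_zeta_domain]]],
        auto simp: Complex_in_zeta_domain intro!: continuous_on_Complex continuous_intros)+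
  have der: "(?g has_vector_derivative ?g' t) (at t within {0..T})" for t
  proof -
    have "(Complex 1 has_vector_derivative \<i>) (at t within {0..T})"
      unfolding Complex_eq by (auto intro!: derivative_eq_intros)
    then have "(?Z has_vector_derivative (\<i> * ?Z' t)) (at t within {0..T})"
      using field_vector_diff_chain_within[of "Complex 1" \<i> t "{0..T}" zeta_remainder "?Z' t"]
        holomorphic_derivI[OF zeta_remainder_holomorphic open_zeta_domain Complex_in_zeta_domain[of 1 t]]
      by (auto simp: o_def intro: has_field_derivative_at_within)
    moreover have "((\<lambda>t. of_real (1 - t / T) :: complex) has_vector_derivative of_real (- 1 / T)) (at t within {0..T})"
      by (intro has_vector_derivative_of_real) (use T in \<open>auto intro!: derivative_eq_intros\<close>)
    ultimately show ?thesis by (intro has_vector_derivative_mult)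
  qed
  have "((\<lambda>u. integral {0..T} (\<lambda>t. cis (t * u) * ?g t)) \<longlongrightarrow> 0) at_top"
    by (rule oscillatory_integral_tendsto_0[OF T der]) (use T in \<open>auto intro!: continuous_intros cont\<close>)
  from tendsto_Re[OF this]
  have "((\<lambda>u. Re (integral {0..T} (\<lambda>t. cis (t * u) * ?g t))) \<longlongrightarrow> 0) at_top" by simp
  moreover have "Re (integral {0..T} (\<lambda>t. cis (t * u) * ?g t)) = fejer_remainder T 1 u" for u
  proof -
    have "(\<lambda>t. cis (t * u) * ?g t) integrable_on {0..T}"
      using T by (auto intro!: integrable_continuous_interval continuous_intros cont)
    from integral_linear[OF this bounded_linear_Re]
    have "Re (integral {0..T} (\<lambda>t. cis (t * u) * ?g t)) = integral {0..T} (\<lambda>t. Re (cis (t * u) * ?g t))"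
      unfolding o_def by (rule sym)
    moreover have "Re (cis (t * u) * ?g t) = (1 - t / T) * Re (cis (t * u) * ?Z t)" for t
      by (simp add: algebra_simps diff_divide_distrib)
    ultimately show ?thesis unfolding fejer_remainder_def by (simp only:)
  qed
  ultimately show ?thesis by simp
qed

section \<open>Bounds for the smoothed mass of the integers and of \<Lambda>\<close>

lemma cauchy_sum_le: "(\<Sum>n<M. 1 / real n * (1 / (1 + (ln (real n) - u)\<^sup>2))) \<le> 1 + 3 * pi"
proof -
  define f where "f = (\<lambda>n. 1 / real n * (1 / (1 + (ln (real n) - u)\<^sup>2)))"
  define A where "A = (\<lambda>n. arctan (ln (real (Suc n)) - u))"
  have f0: "f n \<ge> 0" for n by (simp add: f_def add_nonneg_nonneg)
  \<comment> \<open>The mean value theorem compares the term with the increment of arctan (ln x -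
    u), whose derivative is the summand as a function of x. Moving between the endpoint and the
    intermediate point changes the logarithm by at most 1, hence the factor 3.\<close>
  have step: "f (Suc (Suc n)) \<le> 3 * (A (Suc n) - A n)" for n
  proof -
    let ?b = "real (Suc (Suc n))" and ?a = "real (Suc n)"
    have "\<exists>z. ?a < z \<and> z < ?b \<and> arctan (ln ?b - u) - arctan (ln ?a - u) =
        (?b - ?a) * (inverse (1 + (ln z - u)\<^sup>2) * (1 / z))"
      by (rule MVT2) (auto intro!: derivative_eq_intros)
    then obtain z where z: "?a < z" "z < ?b" "A (Suc n) - A n = inverse (1 + (ln z - u)\<^sup>2) * (1 / z)"
      by (auto simp: A_def)
    have "ln ?b - ln z \<le> ln ?b - ln ?a" using z(1) by simp
    also have "\<dots> = ln (?b / ?a)" by (simp add: ln_div)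
    also have "\<dots> \<le> ?b / ?a - 1" by (rule ln_le_minus_one) simp
    also have "\<dots> \<le> 1" by (simp add: field_simps)
    finally have "\<bar>ln z - ln ?b\<bar> \<le> 1" using z by simp
    from cauchy_shift_le[OF this, of "ln ?b - u"]
    have "1 / (1 + (ln ?b - u)\<^sup>2) \<le> 3 * (1 / (1 + (ln z - u)\<^sup>2))" by simp
    moreover have "1 / ?b \<le> 1 / z" using z by (intro divide_left_mono) auto
    ultimately have "f (Suc (Suc n)) \<le> (1 / z) * (3 * (1 / (1 + (ln z - u)\<^sup>2)))"
      unfolding f_def using z by (intro mult_mono) (auto simp: add_nonneg_nonneg)
    also have "\<dots> = 3 * (A (Suc n) - A n)" unfolding z(3) by (simp add: inverse_eq_divide)
    finally show ?thesis .
  qed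
  have "(\<Sum>n<M. f n) \<le> (\<Sum>n<Suc (Suc M). f n)"
    using f0 by (intro sum_mono2) auto
  also have "\<dots> = f 0 + (f 1 + (\<Sum>n<M. f (Suc (Suc n))))"
    \<comment> \<open>The comparison starts at index 2. The term \<open>f 1\<close> is at most 1,
      and \<open>f 0\<close> is 0 because division by zero yields 0.\<close>
    by (simp add: sum.lessThan_Suc_shift del: sum.lessThan_Suc)
  also have "(\<Sum>n<M. f (Suc (Suc n))) \<le> (\<Sum>n<M. 3 * (A (Suc n) - A n))"
    by (intro sum_mono step)
  also have "\<dots> = 3 * (A M - A 0)"
    by (simp only: sum_distrib_left[symmetric] sum_lessThan_telescope)
  also have "\<dots> \<le> 3 * pi"
    using arctan_lbound[of "ln (real (Suc 0)) - u"] arctan_ubound[of "ln (real (Suc M)) - u"]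
    unfolding A_def by simp
  also have "f 1 \<le> 1" unfolding f_def by (simp add: add_pos_nonneg)
  finally show ?thesis by (simp add: f_def)
qed

text \<open>The general weights cover n^(-\<sigma>) for every \<sigma> > 1 with one bound, uniform
  in \<sigma>, M and u; this survives the limit \<sigma> \<longlongrightarrow> 1.\<close>

lemma fejer_sum_le:
  assumes T: "T > 0" and w: "\<And>n. 0 \<le> w n \<and> w n \<le> 1 / real n"
  shows "(\<Sum>n<M. w n * fejer T (ln (real n) - u)) \<le> (T / 2 + 2 / T) * (1 + 3 * pi)"
proof -
  have "(\<Sum>n<M. w n * fejer T (ln (real n) - u)) \<le>
      (\<Sum>n<M. 1 / real n * ((T / 2 + 2 / T) * (1 / (1 + (ln (real n) - u)\<^sup>2))))"
    using T w by (intro sum_mono mult_mono fejer_le_cauchy fejer_nonneg) auto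
  also have "\<dots> = (T / 2 + 2 / T) * (\<Sum>n<M. 1 / real n * (1 / (1 + (ln (real n) - u)\<^sup>2)))"
    unfolding sum_distrib_left by (intro sum.cong) auto
  also have "\<dots> \<le> (T / 2 + 2 / T) * (1 + 3 * pi)"
    using T cauchy_sum_le by (intro mult_left_mono) auto
  finally show ?thesis .
qed

lemma powr_minus_le_inverse: "\<sigma> > 1 \<Longrightarrow> real n powr (-\<sigma>) \<le> 1 / real n"
  using powr_mono[of "-\<sigma>" "-1" "real n"] by (cases "n = 0") (auto simp: powr_minus_divide)

lemma powr_minus_tendsto_inverse: "((\<lambda>\<sigma>. real n powr (-\<sigma>)) \<longlongrightarrow> 1 / real n) (at_right 1)"
proof (cases "n = 0")
  case False
  have "((\<lambda>\<sigma>. real n powr (-\<sigma>)) \<longlongrightarrow> real n powr (-1)) (at_right 1)"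
    using False by (intro tendsto_intros) auto
  then show ?thesis using False by (simp add: powr_minus_divide)
qed auto

text \<open>For \<sigma> > 1 the \<Lambda>-mass is the integer mass plus the remainder. Since its
  terms are nonnegative, each partial sum lies below the whole; with M fixed, \<sigma> can then tend
  to 1 in a finite sum.\<close>

lemma mangoldt_fejer_upper:
  assumes T: "T > 0"
  shows "(\<Sum>n<M. mangoldt n / real n * fejer T (ln (real n) - u))
           \<le> (T / 2 + 2 / T) * (1 + 3 * pi) + fejer_remainder T 1 u"
proof -
  let ?k = "\<lambda>n. fejer T (ln (real n) - u)" and ?K = "(T / 2 + 2 / T) * (1 + 3 * pi)"
  have "(\<Sum>n<M. mangoldt n * real n powr (-\<sigma>) * ?k n) \<le> ?K + fejer_remainder T \<sigma> u" if \<sigma>: "\<sigma> > 1" for \<sigma>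
  proof -
    have "(\<lambda>M. \<Sum>n<M. (mangoldt n - 1) * real n powr (-\<sigma>) * ?k n) \<longlonglongrightarrow> fejer_remainder T \<sigma> u"
      using mangoldt_fejer_sums[OF T \<sigma>] by (simp add: sums_def)
    then show ?thesis
    proof (rule tendsto_lowerbound[OF tendsto_add[OF tendsto_const]])
      show "\<forall>\<^sub>F M' in sequentially. (\<Sum>n<M. mangoldt n * real n powr (-\<sigma>) * ?k n)
              \<le> ?K + (\<Sum>n<M'. (mangoldt n - 1) * real n powr (-\<sigma>) * ?k n)"
        using eventually_ge_at_top[of M]
      proof eventually_elim
        case (elim M')
        have "(\<Sum>n<M. mangoldt n * real n powr (-\<sigma>) * ?k n) \<le> (\<Sum>n<M'. mangoldt n * real n powr (-\<sigma>) * ?k n)"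
          using elim T by (intro sum_mono2) (auto intro!: mult_nonneg_nonneg mangoldt_nonneg fejer_nonneg)
        also have "\<dots> = (\<Sum>n<M'. real n powr (-\<sigma>) * ?k n) + (\<Sum>n<M'. (mangoldt n - 1) * real n powr (-\<sigma>) * ?k n)"
          unfolding sum.distrib[symmetric] by (intro sum.cong) (auto simp: algebra_simps)
        also have "(\<Sum>n<M'. real n powr (-\<sigma>) * ?k n) \<le> ?K"
          using T \<sigma> by (intro fejer_sum_le) (auto intro!: powr_minus_le_inverse)
        finally show ?case by simp
      qed
    qed auto
  qed
  then have "\<forall>\<^sub>F \<sigma> in at_right 1. (\<Sum>n<M. mangoldt n * real n powr (-\<sigma>) * ?k n) \<le> ?K + fejer_remainder T \<sigma> u"
    by (auto intro!: eventually_at_rightI[of 1 2])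
  moreover have "((\<lambda>\<sigma>. \<Sum>n<M. mangoldt n * real n powr (-\<sigma>) * ?k n) \<longlongrightarrow>
      (\<Sum>n<M. mangoldt n * (1 / real n) * ?k n)) (at_right 1)"
    by (intro tendsto_sum tendsto_mult tendsto_const powr_minus_tendsto_inverse)
  moreover have "((\<lambda>\<sigma>. ?K + fejer_remainder T \<sigma> u) \<longlongrightarrow> ?K + fejer_remainder T 1 u) (at_right 1)"
    by (intro tendsto_add tendsto_const fejer_remainder_tendsto T)
  ultimately have "(\<Sum>n<M. mangoldt n * (1 / real n) * ?k n) \<le> ?K + fejer_remainder T 1 u"
    by (intro tendsto_le[of "at_right 1"]) auto
  then show ?thesis by simp
qed

text \<open>The converse transfer: a bound on the \<Lambda>-mass at \<sigma> = 1 also holds for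
  \<sigma> > 1 because n^(-\<sigma>) \<le> 1/n, and passes through the remainder to partial sums
  over the integers.\<close>

lemma mangoldt_fejer_lower:
  assumes T: "T > 0" and B: "\<And>M. (\<Sum>n<M. mangoldt n / real n * fejer T (ln (real n) - u)) \<le> B"
  shows "(\<Sum>n<M. 1 / real n * fejer T (ln (real n) - u)) + fejer_remainder T 1 u \<le> B"
proof -
  let ?k = "\<lambda>n. fejer T (ln (real n) - u)"
  have "(\<Sum>n<M. real n powr (-\<sigma>) * ?k n) + fejer_remainder T \<sigma> u \<le> B" if \<sigma>: "\<sigma> > 1" for \<sigma>
  proof -
    have "(\<lambda>M. \<Sum>n<M. (mangoldt n - 1) * real n powr (-\<sigma>) * ?k n) \<longlonglongrightarrow> fejer_remainder T \<sigma> u"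
      using mangoldt_fejer_sums[OF T \<sigma>] by (simp add: sums_def)
    then show ?thesis
    proof (rule tendsto_upperbound[OF tendsto_add[OF tendsto_const]])
      show "\<forall>\<^sub>F M' in sequentially. (\<Sum>n<M. real n powr (-\<sigma>) * ?k n)
              + (\<Sum>n<M'. (mangoldt n - 1) * real n powr (-\<sigma>) * ?k n) \<le> B"
        using eventually_ge_at_top[of M]
      proof eventually_elim
        case (elim M')
        have "(\<Sum>n<M. real n powr (-\<sigma>) * ?k n) \<le> (\<Sum>n<M'. real n powr (-\<sigma>) * ?k n)"
          using elim T by (intro sum_mono2) (auto intro!: mult_nonneg_nonneg fejer_nonneg)
        also have "\<dots> = (\<Sum>n<M'. mangoldt n * real n powr (-\<sigma>) * ?k n)
            - (\<Sum>n<M'. (mangoldt n - 1) * real n powr (-\<sigma>) * ?k n)"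
          unfolding sum_subtractf[symmetric] by (intro sum.cong) (auto simp: algebra_simps)
        also have "(\<Sum>n<M'. mangoldt n * real n powr (-\<sigma>) * ?k n) \<le> (\<Sum>n<M'. mangoldt n * (1 / real n) * ?k n)"
          using T \<sigma> by (intro sum_mono mult_right_mono mult_left_mono powr_minus_le_inverse)
            (auto intro!: mangoldt_nonneg fejer_nonneg)
        also have "\<dots> \<le> B" using B by simp
        finally show ?case by simp
      qed
    qed auto
  qed
  then have "\<forall>\<^sub>F \<sigma> in at_right 1. (\<Sum>n<M. real n powr (-\<sigma>) * ?k n) + fejer_remainder T \<sigma> u \<le> B"
    by (auto intro!: eventually_at_rightI[of 1 2])
  moreover have "((\<lambda>\<sigma>. (\<Sum>n<M. real n powr (-\<sigma>) * ?k n) + fejer_remainder T \<sigma> u) \<longlongrightarrow>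
      (\<Sum>n<M. (1 / real n) * ?k n) + fejer_remainder T 1 u) (at_right 1)"
    by (intro tendsto_add tendsto_sum tendsto_mult tendsto_const powr_minus_tendsto_inverse
          fejer_remainder_tendsto T)
  ultimately show ?thesis by (intro tendsto_upperbound) auto
qed

text \<open>Obtained from the kernel with T = 1 at the two centres u and u - 1. The bound does not
  involve the larger T used later, so that T may be chosen in terms of C.\<close>

lemma mangoldt_cauchy_bounded:
  obtains C where "C > 0"
    "\<forall>\<^sub>F u in at_top. \<forall>M. (\<Sum>n<M. mangoldt n / real n * (1 / (1 + (ln (real n) - u)\<^sup>2))) \<le> C"
proof -
  obtain c where c: "c > 0" "\<And>v. c * (1 / (1 + v\<^sup>2)) \<le> fejer 1 v + fejer 1 (v + 1)"
    by (rule cauchy_le_fejer) blast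
  \<comment> \<open>The factor 5/2 is T/2 + 2/T at T = 1; the final 1 bounds the remainder for large
    u.\<close>
  define K where "K = (5 / 2) * (1 + 3 * pi) + 1"
  have K: "K > 0" using pi_gt_zero by (auto simp: K_def intro!: add_pos_pos)
  have R: "\<forall>\<^sub>F u in at_top. fejer_remainder 1 1 u < 1"
    using order_tendstoD(2)[OF fejer_remainder_tendsto_0[of 1], of 1] by simp
  have "filterlim (\<lambda>u::real. u - 1) at_top at_top"
    using filterlim_tendsto_add_at_top[OF tendsto_const[of "-1::real"] filterlim_ident] by simp
  then have "\<forall>\<^sub>F u in at_top. fejer_remainder 1 1 (u - 1) < 1"
    using R by (rule eventually_compose_filterlim[rotated])
  with R have "\<forall>\<^sub>F u in at_top. \<forall>M. (\<Sum>n<M. mangoldt n / real n * (1 / (1 + (ln (real n) - u)\<^sup>2))) \<le> 2 * K / c"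
  proof eventually_elim
    case (elim u)
    show ?case
    proof
      fix M
      have "c * (\<Sum>n<M. mangoldt n / real n * (1 / (1 + (ln (real n) - u)\<^sup>2))) =
          (\<Sum>n<M. mangoldt n / real n * (c * (1 / (1 + (ln (real n) - u)\<^sup>2))))"
        unfolding sum_distrib_left by (intro sum.cong) auto
      also have "\<dots> \<le> (\<Sum>n<M. mangoldt n / real n * (fejer 1 (ln (real n) - u) + fejer 1 (ln (real n) - (u - 1))))"
        using c(2)[of "ln (real n) - u" for n]
        by (intro sum_mono mult_left_mono) (auto simp: mangoldt_nonneg algebra_simps)
      also have "\<dots> = (\<Sum>n<M. mangoldt n / real n * fejer 1 (ln (real n) - u)) +
          (\<Sum>n<M. mangoldt n / real n * fejer 1 (ln (real n) - (u - 1)))"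
        unfolding sum.distrib[symmetric] by (intro sum.cong) (auto simp: algebra_simps)
      also have "\<dots> \<le> K + K"
        using mangoldt_fejer_upper[of 1 u M] mangoldt_fejer_upper[of 1 "u - 1" M] elim
        unfolding K_def by (intro add_mono) simp_all
      finally show "(\<Sum>n<M. mangoldt n / real n * (1 / (1 + (ln (real n) - u)\<^sup>2))) \<le> 2 * K / c"
        using c(1) by (simp add: pos_le_divide_eq mult.commute)
    qed
  qed
  then show ?thesis using that[of "2 * K / c"] K c(1) by simp
qed

text \<open>There are about E / T integers between E = exp u and E exp (1/T), each contributing at
  least (1 / (3 E)) (T / 4), so T cancels. The assumption E \<ge> 6 T keeps the rounding loss below
  one sixth, leaving 5/72 \<ge> 1/24.\<close>

lemma fejer_sum_ge:
  assumes T: "T \<ge> 1" and u: "u \<ge> ln (6 * T)"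
  obtains M where "(\<Sum>n<M. 1 / real n * fejer T (ln (real n) - u)) \<ge> 1 / 24"
proof
  define E where "E = exp u"
  define y where "y = exp (1 / T)"
  define a b where "a = nat \<lceil>E\<rceil>" and "b = nat \<lfloor>E * y\<rfloor>"
  have "exp (ln (6 * T)) \<le> exp u" using u by simp
  then have E: "E \<ge> 6 * T" using T by (simp add: E_def)
  have y: "1 + 1 / T \<le> y" "y \<le> 3"
    using exp_ge_add_one_self[of "1 / T"] exp_le T exp_le_cancel_iff[of "1 / T" 1]
    unfolding y_def by (auto simp del: exp_le_cancel_iff intro: order_trans[OF _ exp_le])
  have E0: "E > 0" by (simp add: E_def)
  have Ey: "E * y \<ge> E + E / T" using mult_left_mono[OF y(1), of E] E0 by (simp add: algebra_simps)
  have ab: "real a \<le> E + 1" "real b \<ge> E * y - 1" "real b \<le> E * y" "real a \<ge> E"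
  proof -
    have "E * y \<ge> 0" using E0 by (simp add: y_def)
    then have "real a = of_int \<lceil>E\<rceil>" "real b = of_int \<lfloor>E * y\<rfloor>" using E0 by (simp_all add: a_def b_def)
    then show "real a \<le> E + 1" "real b \<ge> E * y - 1" "real b \<le> E * y" "real a \<ge> E" by linarith+
  qed
  have "5 / 6 * (E / T) \<le> E / T - 1" using E T by (simp add: field_simps)
  also have "\<dots> \<le> real b + 1 - real a" using ab Ey by linarith
  also have "\<dots> \<le> real (card {a..b})" by simp
  finally have card: "5 / 6 * (E / T) \<le> real (card {a..b})" .
  have "1 / 24 \<le> 5 / 6 * (E / T) * (1 / (3 * E) * (T / 4))" using E0 T by simp
  also have "\<dots> \<le> real (card {a..b}) * (1 / (3 * E) * (T / 4))"
    using card E0 T by (intro mult_right_mono) auto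
  also have "\<dots> = (\<Sum>n\<in>{a..b}. 1 / (3 * E) * (T / 4))" by simp
  also have "\<dots> \<le> (\<Sum>n\<in>{a..b}. 1 / real n * fejer T (ln (real n) - u))"
  proof (intro sum_mono mult_mono)
    fix n assume n: "n \<in> {a..b}"
    have n1: "E \<le> real n" "real n \<le> E * y" using n ab by auto
    have "E * y \<le> E * 3" using y E0 by (intro mult_left_mono) auto
    then have "real n \<le> 3 * E" using n1 by linarith
    then show "1 / (3 * E) \<le> 1 / real n" using n1 E0 by (intro divide_left_mono) auto
    have "ln E \<le> ln (real n)" "ln (real n) \<le> ln (E * y)" using n1 E0 by (auto intro!: ln_mono)
    then have "u \<le> ln (real n)" "ln (real n) \<le> u + 1 / T"
      by (simp_all add: E_def y_def flip: exp_add)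
    then show "T / 4 \<le> fejer T (ln (real n) - u)" using T by (intro fejer_ge) auto
  qed (use T E0 in auto)
  also have "\<dots> \<le> (\<Sum>n<Suc b. 1 / real n * fejer T (ln (real n) - u))"
    using T by (intro sum_mono2) (auto intro!: divide_nonneg_nonneg fejer_nonneg)
  finally show "(\<Sum>n<Suc b. 1 / real n * fejer T (ln (real n) - u)) \<ge> 1 / 24" .
qed

section \<open>From prime powers to primes\<close>

lemma summable_mangoldt_nonprime: "summable (\<lambda>n. if prime n then 0 else mangoldt n / real n)"
proof (rule summableI_nonneg_bounded)
  let ?f = "\<lambda>n::nat. if prime n then 0 else mangoldt n / real n"
  let ?h = "\<lambda>p::nat. ln (real p) * real p powr (-2)"
  fix M :: nat
  let ?P = "({2..<M} \<times> {..<M})"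
  let ?g = "\<lambda>(p, j). ln (real p) / real p ^ (j + 2)"
  define S where "S = {n. n < M \<and> primepow n \<and> \<not> prime n}"
  have "(\<Sum>n<M. ?f n) = (\<Sum>n\<in>S. ?f n)"
    unfolding S_def by (intro sum.mono_neutral_right) (auto simp: mangoldt_def)
  also have "\<dots> \<le> sum ?g ?P"
  \<comment> \<open>Each proper prime power is p^(j + 2) for some (p, j) in the box, both entries
    being below M as p and j + 2 do not exceed p^(j + 2). For fixed p the geometric series in j is
    at most 2 ln p / p^2.\<close>
  proof (rule sum_le_included[where i = "\<lambda>(p, j). p ^ (j + 2)"])
    show "finite S" unfolding S_def by auto
    show "\<forall>y\<in>?P. 0 \<le> ?g y" by auto
    show "\<forall>n\<in>S. \<exists>y\<in>?P. (case y of (p, j) \<Rightarrow> p ^ (j + 2)) = n \<and> ?f n \<le> ?g y"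
    proof
      fix n assume "n \<in> S"
      then have n: "n < M" "primepow n" "\<not> prime n" by (auto simp: S_def)
      then obtain p k where pk: "prime p" "k > 0" "n = p ^ k" by (auto simp: primepow_def)
      then have "k \<noteq> 1" using n by auto
      then have "k = (k - 2) + 2" using pk(2) by simp
      then obtain j where j: "k = j + 2" by blast
      have p2: "p \<ge> 2" using pk(1) by (rule prime_ge_2_nat)
      have "p \<le> p ^ k" using pk(2) p2 by (intro self_le_power) auto
      moreover have "k < p ^ k" using p2 less_exp[of k] power_mono[of 2 p k] by linarith
      ultimately have "p < M" "j < M" using n(1) j unfolding pk(3) by linarith+
      then have "(p, j) \<in> ?P" using p2 by simp
      moreover have "mangoldt n = ln (real p)"
        using mangoldt_primepow'[OF pk(1,2), where ?'a = real] pk(3) by simp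
      moreover have "real n = real p ^ (j + 2)" by (simp add: pk(3) j)
      ultimately have "(p, j) \<in> ?P" "?f n \<le> ?g (p, j)" by (simp_all only: n(3) if_False prod.case order_refl)
      then show "\<exists>y\<in>?P. (case y of (p, j) \<Rightarrow> p ^ (j + 2)) = n \<and> ?f n \<le> ?g y"
        using pk(3) j by (intro bexI[of _ "(p, j)"]) auto
    qed
  qed auto
  also have "\<dots> = (\<Sum>p\<in>{2..<M}. \<Sum>j<M. ln (real p) / real p ^ (j + 2))"
    by (simp add: sum.cartesian_product)
  also have "\<dots> \<le> (\<Sum>p\<in>{2..<M}. 2 * ?h p)"
  proof (rule sum_mono)
    fix p assume p: "p \<in> {2..<M}"
    define x where "x = 1 / real p"
    have x: "0 < x" "x \<le> 1 / 2" using p by (auto simp: x_def field_simps)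
    have "(\<Sum>j<M. x ^ j) = (1 - x ^ M) / (1 - x)" using x by (subst sum_gp_strict) auto
    also have "\<dots> \<le> 1 / (1 - x)" using x by (intro divide_right_mono) auto
    also have "\<dots> \<le> 2" using x by (simp add: field_simps)
    finally have gp: "(\<Sum>j<M. x ^ j) \<le> 2" .
    have "(\<Sum>j<M. ln (real p) / real p ^ (j + 2)) = ln (real p) * x\<^sup>2 * (\<Sum>j<M. x ^ j)"
      unfolding sum_distrib_left by (intro sum.cong) (auto simp: x_def power_add power2_eq_square field_simps)
    also have "\<dots> \<le> ln (real p) * x\<^sup>2 * 2" using gp p by (intro mult_left_mono) auto
    also have "\<dots> = 2 * ?h p" using p by (simp add: x_def powr_minus_divide field_simps)
    finally show "(\<Sum>j<M. ln (real p) / real p ^ (j + 2)) \<le> 2 * ?h p" .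
  qed
  also have "\<dots> \<le> (\<Sum>p<M. 2 * ?h p)"
    by (intro sum_mono2) (auto simp: not_le less_Suc_eq numeral_2_eq_2)
  also have "\<dots> \<le> (\<Sum>p. 2 * ?h p)"
  proof (intro sum_le_suminf summable_mult summable_ln_powr ballI)
    fix n :: nat show "0 \<le> 2 * ?h n" by (cases "n = 0") auto
  qed auto
  finally show "(\<Sum>n<M. ?f n) \<le> (\<Sum>p. 2 * ?h p)" .
qed (auto simp: mangoldt_nonneg)

text \<open>Without such a prime the \<Lambda>-mass around u would be at most 1/48, whereas the
  integers have mass at least 1/24 and the remainder exceeds -1/96.\<close>

lemma eventually_prime_near_exp:
  assumes "\<epsilon> > 0"
  shows "\<forall>\<^sub>F u in at_top. \<exists>p::nat. prime p \<and> \<bar>ln (real p) - u\<bar> < \<epsilon>"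
proof -
  obtain C where C: "C > 0"
    "\<forall>\<^sub>F u in at_top. \<forall>M. (\<Sum>n<M. mangoldt n / real n * (1 / (1 + (ln (real n) - u)\<^sup>2))) \<le> C"
    by (rule mangoldt_cauchy_bounded)
  \<comment> \<open>For |v| \<ge> \<epsilon> this gives 1 / v^2 \<le> D / (1 + v^2), turning the
    decay of the Fejer kernel into the Cauchy kernel already controlled by C.\<close>
  define D where "D = 1 + 1 / \<epsilon>\<^sup>2"
  have D: "D > 0" by (simp add: D_def add_pos_nonneg)
  \<comment> \<open>This makes the far contribution 2 D C / T at most 1/96. The tail bound 1 / (48
    T) chosen below, multiplied by the peak T/2 of the kernel, gives another 1/96.\<close>
  define T where "T = max 1 (192 * D * C)"
  have T: "T \<ge> 1" "192 * D * C \<le> T" by (auto simp: T_def)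
  define f :: "nat \<Rightarrow> real" where "f = (\<lambda>n. if prime n then 0 else mangoldt n / real n)"
  have f0: "f n \<ge> 0" for n by (simp add: f_def mangoldt_nonneg)
  have "\<exists>N. \<forall>m\<ge>N. \<forall>n. norm (sum f {m..<n}) < 1 / (48 * T)"
    using summable_mangoldt_nonprime[folded f_def] T unfolding summable_Cauchy by simp
  then obtain N where N: "\<And>m n. m \<ge> N \<Longrightarrow> norm (sum f {m..<n}) < 1 / (48 * T)" by blast
  define N0 where "N0 = max N 1"
  have tail: "(\<Sum>n<M. if n \<ge> N0 then f n else 0) \<le> 1 / (48 * T)" for M
  proof -
    have "(\<Sum>n<M. if n \<ge> N0 then f n else 0) = sum f {N0..<M}"
      by (intro sum.mono_neutral_cong_right) auto
    then show ?thesis using N[of N0 M] by (simp add: N0_def)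
  qed
  have R: "\<forall>\<^sub>F u in at_top. fejer_remainder T 1 u > - 1 / 96"
    using order_tendstoD(1)[OF fejer_remainder_tendsto_0[of T], of "- 1 / 96"] T by simp
  show ?thesis
    using C(2) R eventually_ge_at_top[of "ln (6 * T)"] eventually_ge_at_top[of "ln (real N0) + \<epsilon>"]
  proof eventually_elim
    case (elim u)
    show ?case
    proof (rule ccontr)
      assume no: "\<not> (\<exists>p::nat. prime p \<and> \<bar>ln (real p) - u\<bar> < \<epsilon>)"
      let ?q = "\<lambda>n. 1 / (1 + (ln (real n) - u)\<^sup>2)"
      \<comment> \<open>Near u no index is prime and u is large enough to force n \<ge> N0, so the
        weight is part of the small tail; elsewhere the kernel decays like 1 / (T v^2).\<close>
      have pt: "mangoldt n / real n * fejer T (ln (real n) - u) \<le>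
          2 / T * D * (mangoldt n / real n * ?q n) + T / 2 * (if n \<ge> N0 then f n else 0)" for n
      proof (cases "n = 0")
        case False
        let ?v = "ln (real n) - u"
        have L: "mangoldt n / real n \<ge> 0" by (simp add: mangoldt_nonneg)
        have q0: "?q n \<ge> 0" by (simp add: add_nonneg_nonneg)
        show ?thesis
        proof (cases "\<bar>?v\<bar> < \<epsilon>")
          case True
          then have np: "\<not> prime n" using no by blast
          have "ln (real N0) < ln (real n)" using True elim by linarith
          then have "N0 \<le> n" using False by (simp add: N0_def)
          then have "(if n \<ge> N0 then f n else 0) = mangoldt n / real n" using np by (simp add: f_def)
          moreover have "mangoldt n / real n * fejer T ?v \<le> T / 2 * (mangoldt n / real n)"
            using mult_left_mono[OF fejer_le_half[of T ?v] L] T by (simp add: mult.commute)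
          moreover have "0 \<le> 2 / T * D * (mangoldt n / real n * ?q n)"
            using T D L q0 by (intro mult_nonneg_nonneg) auto
          ultimately show ?thesis by simp
        next
          case far: False
          then have v: "?v \<noteq> 0" "\<epsilon>\<^sup>2 \<le> ?v\<^sup>2"
            using assms by (auto simp: abs_le_square_iff[symmetric])
          have "1 / ?v\<^sup>2 = (1 + 1 / ?v\<^sup>2) * ?q n"
          proof -
            have "1 / x = (1 + 1 / x) * (1 / (1 + x))" if "x > 0" for x :: real
              using that by (simp add: field_simps)
            then show ?thesis using v(1) by simp
          qed
          also have "\<dots> \<le> D * ?q n" unfolding D_def
            using v assms q0 by (intro mult_right_mono add_left_mono divide_left_mono) auto
          finally have Dq: "1 / ?v\<^sup>2 \<le> D * ?q n" .
          have "fejer T ?v \<le> 2 / (T * ?v\<^sup>2)" using v(1) T by (intro fejer_le_square) auto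
          also have "\<dots> = 2 / T * (1 / ?v\<^sup>2)" by simp
          also have "\<dots> \<le> 2 / T * (D * ?q n)" using T by (intro mult_left_mono[OF Dq]) auto
          finally have "fejer T ?v \<le> 2 / T * (D * ?q n)" .
          from mult_left_mono[OF this L]
          have "mangoldt n / real n * fejer T ?v \<le> 2 / T * D * (mangoldt n / real n * ?q n)"
            by (simp only: mult_ac)
          moreover have "0 \<le> T / 2 * (if n \<ge> N0 then f n else 0)" using T f0 by auto
          ultimately show ?thesis by linarith
        qed
      qed (use T f0 in auto)
      have "(\<Sum>n<M. mangoldt n / real n * fejer T (ln (real n) - u)) \<le> 1 / 48" for M
      proof -
        have "(\<Sum>n<M. mangoldt n / real n * fejer T (ln (real n) - u)) \<le>
            2 / T * D * (\<Sum>n<M. mangoldt n / real n * ?q n) + T / 2 * (\<Sum>n<M. if n \<ge> N0 then f n else 0)"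
          unfolding sum_distrib_left sum.distrib[symmetric] by (intro sum_mono pt)
        also have "\<dots> \<le> 2 / T * D * C + T / 2 * (1 / (48 * T))"
          using elim T D tail by (intro add_mono mult_left_mono) auto
        also have "T / 2 * (1 / (48 * T)) = 1 / 96" using T by simp
        also have "2 / T * D * C \<le> 1 / 96" using T by (simp add: field_simps)
        finally show ?thesis by simp
      qed
      moreover obtain M where M: "(\<Sum>n<M. 1 / real n * fejer T (ln (real n) - u)) \<ge> 1 / 24"
        using fejer_sum_ge[OF T(1), of u] elim by blast
      ultimately have "1 / 24 + fejer_remainder T 1 u \<le> 1 / 48"
        using mangoldt_fejer_lower[of T u "1 / 48" M] T by force
      then show False using elim by linarith
    qed
  qed
qed

lemma eventually_prime_between:
  fixes \<epsilon> :: real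
  assumes "\<epsilon> > 0"
  shows "\<forall>\<^sub>F N in sequentially. \<exists>p::nat. prime p \<and> N < p \<and> real p \<le> (1 + \<epsilon>) * real N"
proof -
  \<comment> \<open>With centre ln N + d and radius d, the logarithmic window is exactly (N, (1 +
    \<epsilon>) N).\<close>
  define d where "d = ln (1 + \<epsilon>) / 2"
  have d: "d > 0" using assms by (simp add: d_def)
  have "filterlim (\<lambda>N. d + ln (real N)) at_top sequentially"
    by (intro filterlim_tendsto_add_at_top[OF tendsto_const]
          filterlim_compose[OF ln_at_top filterlim_real_sequentially])
  from eventually_compose_filterlim[OF eventually_prime_near_exp[OF d] this]
  show ?thesis using eventually_gt_at_top[of 0]
  proof eventually_elim
    case (elim N)
    then obtain p :: nat where p: "prime p" "\<bar>ln (real p) - (d + ln (real N))\<bar> < d" by blast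
    have p0: "real p > 0" using prime_gt_0_nat[OF p(1)] by simp
    have "ln (real N) < ln (real p)" using p(2) by linarith
    then have "N < p" using p0 elim by simp
    moreover have "ln (real p) < ln (1 + \<epsilon>) + ln (real N)" using p(2) unfolding d_def by linarith
    then have "ln (real p) < ln ((1 + \<epsilon>) * real N)" using assms elim by (subst ln_mult) auto
    then have "real p < (1 + \<epsilon>) * real N" using p0 assms elim by (subst (asm) ln_less_cancel_iff) auto
    ultimately show ?case using p(1) by (intro exI[of _ p]) auto
  qed
qed

section \<open>Dense Sidon sets\<close>

text \<open>Modulo a prime, sum and product determine the roots of a quadratic: the combination used
  below factors as (x - z) (x - w).\<close>

lemma cong_of_sum_prod_cong:
  fixes x y z w :: int
  assumes "prime p" "[x + y = z + w] (mod p)" "[x * y = z * w] (mod p)"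
  shows "[x = z] (mod p) \<or> [x = w] (mod p)"
proof -
  have "p dvd x * ((x + y) - (z + w)) - (x * y - z * w)"
    using assms(2,3) unfolding cong_iff_dvd_diff by (rule dvd_diff[OF dvd_mult])
  also have "x * ((x + y) - (z + w)) - (x * y - z * w) = (x - z) * (x - w)"
    by (simp add: algebra_simps)
  finally show ?thesis
    using assms(1) by (simp add: prime_dvd_mult_iff cong_iff_dvd_diff)
qed

text \<open>Ruzsa's construction: by the Chinese remainder theorem, sums determine \<open>i + j\<close> modulo
  \<open>p - 1\<close> and \<open>g\<^sup>i + g\<^sup>j\<close> modulo \<open>p\<close>; the former determines the product \<open>g\<^sup>i g\<^sup>j\<close> modulo \<open>p\<close>.\<close>

lemma ruzsa_sidon:
  fixes p :: nat
  assumes p: "prime p"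
  obtains a :: "nat \<Rightarrow> int" where
    "\<And>i. 0 \<le> a i \<and> a i < int p * (int p - 1)"
    "\<And>i j k l. \<lbrakk>i < p - 1; j < p - 1; k < p - 1; l < p - 1; a i + a j = a k + a l\<rbrakk> \<Longrightarrow>
       (i, j) = (k, l) \<or> (i, j) = (l, k)"
proof -
  have p1: "p > 1" using p prime_gt_1_nat by blast
  obtain g where g: "residue_primroot p g" using prime_primitive_root_exists[of p] p p1 by auto
  have ord: "ord p g = p - 1" and cop: "coprime p g"
    using g p by (auto simp: residue_primroot_def totient_prime)
  have inj: "i = k" if "i < p - 1" "k < p - 1" "[int g ^ i = int g ^ k] (mod int p)" for i k
  proof -
    have "[g ^ i = g ^ k] (mod p)" using that(3) by (simp flip: cong_int_iff)
    then have "[i = k] (mod (p - 1))" using order_divides_expdiff[OF cop] ord by simp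
    then show ?thesis using that by (simp add: cong_def)
  qed
  let ?P = "int p" and ?G = "int g"
  \<comment> \<open>An explicit Chinese remainder solution: b i is congruent to g^i modulo p and to
    i modulo p - 1.\<close>
  define b where "b = (\<lambda>i. ?P * int i - (?P - 1) * ?G ^ i)"
  define a where "a = (\<lambda>i. b i mod (?P * (?P - 1)))"
  have pos: "?P * (?P - 1) > 0" using p1 by simp
  show ?thesis
  proof
    fix i show "0 \<le> a i \<and> a i < ?P * (?P - 1)" unfolding a_def using pos by simp
  next
    fix i j k l
    assume *: "i < p - 1" "j < p - 1" "k < p - 1" "l < p - 1" and eq: "a i + a j = a k + a l"
    have "[b i + b j = a i + a j] (mod (?P * (?P - 1)))" "[a k + a l = b k + b l] (mod (?P * (?P - 1)))"
      by (auto simp: a_def intro!: cong_add)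
    then have "[b i + b j = b k + b l] (mod (?P * (?P - 1)))" using eq by (metis cong_trans)
    then have "?P * (?P - 1) dvd (b i + b j) - (b k + b l)" by (simp add: cong_iff_dvd_diff)
    then have d1: "?P dvd (b i + b j) - (b k + b l)" and d2: "?P - 1 dvd (b i + b j) - (b k + b l)"
      by (auto elim: dvd_mult_left dvd_mult_right)
    \<comment> \<open>The difference of the sums is p I - (p - 1) G, where I and G are the
      differences of the exponent sums and of the power sums. Subtracting p (I - G) leaves G; below,
      subtracting (p - 1) (I - G) leaves I.\<close>
    have "?P dvd ((b i + b j) - (b k + b l)) - ?P * (int i + int j - int k - int l
        - (?G ^ i + ?G ^ j - ?G ^ k - ?G ^ l))"
      by (rule dvd_diff[OF d1 dvd_triv_left])
    also have "\<dots> = (?G ^ i + ?G ^ j) - (?G ^ k + ?G ^ l)"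
      by (simp add: b_def algebra_simps)
    finally have sum: "[?G ^ i + ?G ^ j = ?G ^ k + ?G ^ l] (mod ?P)" by (simp add: cong_iff_dvd_diff)
    have "?P - 1 dvd ((b i + b j) - (b k + b l)) - (?P - 1) * (int i + int j - int k - int l
        - (?G ^ i + ?G ^ j - ?G ^ k - ?G ^ l))"
      by (rule dvd_diff[OF d2 dvd_triv_left])
    also have "\<dots> = int (i + j) - int (k + l)"
      by (simp add: b_def algebra_simps)
    finally have "[int (i + j) = int (k + l)] (mod int (p - 1))"
      using p1 by (simp add: cong_iff_dvd_diff of_nat_diff)
    then have "[i + j = k + l] (mod (p - 1))" by (simp only: cong_int_iff)
    then have "[g ^ (i + j) = g ^ (k + l)] (mod p)" using order_divides_expdiff[OF cop] ord by simp
    then have prod: "[?G ^ i * ?G ^ j = ?G ^ k * ?G ^ l] (mod ?P)"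
      by (simp flip: cong_int_iff add: power_add)
    have "[?G ^ i = ?G ^ k] (mod ?P) \<or> [?G ^ i = ?G ^ l] (mod ?P)"
      using cong_of_sum_prod_cong[OF _ sum prod] p by simp
    then show "(i, j) = (k, l) \<or> (i, j) = (l, k)"
    proof
      assume c: "[?G ^ i = ?G ^ k] (mod ?P)"
      then have "i = k" using inj * by blast
      moreover have "[?G ^ j = ?G ^ l] (mod ?P)" using sum \<open>i = k\<close> by (simp add: cong_add_lcancel)
      then have "j = l" using inj * by blast
      ultimately show ?thesis by simp
    next
      assume c: "[?G ^ i = ?G ^ l] (mod ?P)"
      then have "i = l" using inj * by blast
      moreover have "[?G ^ j = ?G ^ k] (mod ?P)"
        using sum \<open>i = l\<close> by (simp add: cong_add_lcancel add.commute[of "?G ^ k"])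
      then have "j = k" using inj * by blast
      ultimately show ?thesis by simp
    qed
  qed
qed

section \<open>Lower bound for the span of a separated Sidon set\<close>

lemma separated_sum_ge:
  fixes S :: "real set"
  assumes "finite S" "\<delta> \<ge> 0" "\<And>s. s \<in> S \<Longrightarrow> s \<ge> 0"
    "\<And>s t. \<lbrakk>s \<in> S; t \<in> S; s \<noteq> t\<rbrakk> \<Longrightarrow> \<bar>s - t\<bar> \<ge> \<delta>"
  shows "\<Sum>S \<ge> \<delta> * (real (card S) * (real (card S) - 1) / 2)"
proof -
  \<comment> \<open>The first conjunct strengthens the induction: it places each new maximum at
    height at least \<delta> times the number of smaller elements. The clause x \<ge> 0 covers the
    empty set.\<close>
  have "(\<forall>x\<ge>0. (\<forall>a\<in>S. x \<ge> a + \<delta>) \<longrightarrow> x \<ge> \<delta> * real (card S)) \<and>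
      \<Sum>S \<ge> \<delta> * (real (card S) * (real (card S) - 1) / 2)"
    using assms(1,3,4)
  proof (induction S rule: finite_linorder_max_induct)
    case (insert b A)
    then have IH: "\<And>x. x \<ge> 0 \<Longrightarrow> (\<And>a. a \<in> A \<Longrightarrow> x \<ge> a + \<delta>) \<Longrightarrow> x \<ge> \<delta> * real (card A)"
      "\<Sum>A \<ge> \<delta> * (real (card A) * (real (card A) - 1) / 2)"
      by (auto)
    have bA: "b \<notin> A" using insert.hyps by auto
    have b: "b \<ge> \<delta> * real (card A)"
    proof (rule IH(1))
      fix a assume a: "a \<in> A"
      then have "\<bar>b - a\<bar> \<ge> \<delta>" using insert.prems(2)[of b a] bA by auto
      then show "b \<ge> a + \<delta>" using insert.hyps(2) a by force
    qed (use insert.prems in auto)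
    show ?case
    proof (intro conjI allI impI)
      fix x assume "\<forall>a\<in>insert b A. x \<ge> a + \<delta>"
      then have "x \<ge> b + \<delta>" by simp
      then show "x \<ge> \<delta> * real (card (insert b A))"
        using b bA insert.hyps(1) by (simp add: algebra_simps)
    next
      show "\<Sum>(insert b A) \<ge> \<delta> * (real (card (insert b A)) * (real (card (insert b A)) - 1) / 2)"
        using IH(2) b bA insert.hyps(1) by (simp add: algebra_simps add_divide_distrib)
    qed
  qed auto
  then show ?thesis by blast
qed

text \<open>After cancellation only the last r values minus the first r values survive.\<close>

lemma sum_shift_difference_le:
  fixes x :: "nat \<Rightarrow> real"
  assumes "r \<le> N" "\<And>i. i < N \<Longrightarrow> lo \<le> x i \<and> x i \<le> hi"
  shows "(\<Sum>i<N - r. x (i + r) - x i) \<le> real r * (hi - lo)"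
proof -
  have "(\<Sum>i<N - r. x (i + r)) = (\<Sum>i\<in>{r..<N}. x i)"
    using sum.shift_bounds_nat_ivl[of x 0 r "N - r"] assms(1) by (simp add: lessThan_atLeast0)
  also have "\<dots> = (\<Sum>i<N. x i) - (\<Sum>i<r. x i)"
    using sum.atLeastLessThan_concat[of 0 r N x] assms(1) by (simp add: lessThan_atLeast0)
  also have "(\<Sum>i<N. x i) = (\<Sum>i<N - r. x i) + (\<Sum>i\<in>{N - r..<N}. x i)"
    using sum.atLeastLessThan_concat[of 0 "N - r" N x] by (simp add: lessThan_atLeast0)
  finally have "(\<Sum>i<N - r. x (i + r) - x i) = (\<Sum>i\<in>{N - r..<N}. x i) - (\<Sum>i<r. x i)"
    by (simp add: sum_subtractf)
  moreover have "(\<Sum>i\<in>{N - r..<N}. x i) \<le> real (card {N - r..<N}) * hi"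
    using assms by (intro sum_bounded_above) auto
  moreover have "(\<Sum>i<r. x i) \<ge> real (card {..<r}) * lo"
    using assms by (intro sum_bounded_below) auto
  ultimately show ?thesis using assms(1) by (simp add: algebra_simps)
qed

text \<open>At least R (N - R) differences x (i + r) - x i with 1 \<le> r \<le> R are pairwise
  separated, so their sum grows quadratically in that number, while cancellation for each r bounds
  it by 1 + ... + R spans.\<close>

lemma sidon_span_ge:
  fixes x :: "nat \<Rightarrow> real"
  assumes R: "R \<ge> 1" "R \<le> N" and \<delta>: "\<delta> > 0"
    and mono: "\<And>i j. i < j \<Longrightarrow> j < N \<Longrightarrow> x i < x j"
    and sep: "\<And>i j k l. \<lbrakk>i < N; j < N; k < N; l < N; (i, j) \<noteq> (k, l); (i, j) \<noteq> (l, k)\<rbrakk> \<Longrightarrow>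
       \<bar>(x i + x j) - (x k + x l)\<bar> > \<delta>"
    and bd: "\<And>i. i < N \<Longrightarrow> lo \<le> x i \<and> x i \<le> hi"
  shows "\<delta> * (real R * real (N - R) * (real R * real (N - R) - 1)) \<le> real R * (real R + 1) * (hi - lo)"
proof -
  define P where "P = (SIGMA r:{1..R}. {..<N - r})"
  define d where "d = (\<lambda>(r, i). x (i + r) - x i)"
  have fin: "finite P" by (simp add: P_def)
  have dist: "\<bar>d s - d t\<bar> > \<delta>" if "s \<in> P" "t \<in> P" "s \<noteq> t" for s t
  proof -
    obtain r i r' i' where st: "s = (r, i)" "t = (r', i')" by (cases s, cases t)
    \<comment> \<open>Comparing two differences is comparing two sums. The index pairs differ in
      order because r \<ge> 1, and after swapping because (r, i) and (r', i') are distinct.\<close>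
    have "\<bar>(x (i + r) + x i') - (x i + x (i' + r'))\<bar> > \<delta>"
      using that R unfolding st P_def by (intro sep) auto
    then show ?thesis by (simp add: st d_def algebra_simps)
  qed
  have inj: "inj_on d P"
    using dist \<delta> by (intro inj_onI) fastforce
  have "real (R * (N - R)) = real (\<Sum>r\<in>{1..R}. N - R)" by simp
  also have "\<dots> \<le> real (\<Sum>r\<in>{1..R}. N - r)" by (intro of_nat_mono sum_mono) auto
  also have "(\<Sum>r\<in>{1..R}. N - r) = card P" by (simp add: P_def)
  finally have M: "real (R * (N - R)) \<le> real (card P)" .
  have "\<delta> * (real (R * (N - R)) * (real (R * (N - R)) - 1) / 2) \<le> \<delta> * (real (card P) * (real (card P) - 1) / 2)"
  \<comment> \<open>The map k \<mapsto> k (k - 1) is increasing only from k = 1 on the range used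
    here; at k = 0 the left side is simply 0.\<close>
  proof (cases "R * (N - R) = 0")
    case True
    then show ?thesis using \<delta> by (cases "card P = 0") auto
  next
    case False
    then have "real (R * (N - R)) \<ge> 1" by linarith
    then show ?thesis using M \<delta>
      by (intro mult_left_mono divide_right_mono mult_mono) (auto simp del: of_nat_mult of_nat_diff)
  qed
  also have "\<dots> = \<delta> * (real (card (d ` P)) * (real (card (d ` P)) - 1) / 2)"
    using inj by (simp add: card_image)
  also have "\<dots> \<le> \<Sum>(d ` P)"
  proof (rule separated_sum_ge)
    fix s assume "s \<in> d ` P"
    then show "s \<ge> 0" using mono by (force simp: d_def P_def intro!: less_imp_le)
  next
    fix s t assume "s \<in> d ` P" "t \<in> d ` P" "s \<noteq> t"
    then show "\<bar>s - t\<bar> \<ge> \<delta>" using dist by (force intro: less_imp_le)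
  qed (use \<delta> fin in auto)
  also have "\<dots> = (\<Sum>z\<in>P. d z)" using inj by (simp add: sum.reindex)
  also have "\<dots> = (\<Sum>r\<in>{1..R}. \<Sum>i<N - r. x (i + r) - x i)"
    unfolding P_def d_def by (subst sum.Sigma) auto
  also have "\<dots> \<le> (\<Sum>r\<in>{1..R}. real r * (hi - lo))"
    using R bd by (intro sum_mono sum_shift_difference_le) auto
  also have "\<dots> = (real R * (real R + 1) / 2) * (hi - lo)"
    using double_gauss_sum_from_Suc_0[of R, where ?'a = real] by (simp add: sum_distrib_right[symmetric])
  finally show ?thesis by simp
qed

section \<open>Channel configurations\<close>

lemma mem_chan_add_iff: "s \<in> chan W a + chan W b \<longleftrightarrow> \<bar>s - (a + b)\<bar> \<le> W"
proof
  assume "s \<in> chan W a + chan W b"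
  then obtain x y where "s = x + y" "\<bar>x - a\<bar> \<le> W / 2" "\<bar>y - b\<bar> \<le> W / 2"
    by (auto simp: chan_def elim!: set_plus_elim)
  then show "\<bar>s - (a + b)\<bar> \<le> W" by linarith
next
  assume s: "\<bar>s - (a + b)\<bar> \<le> W"
  define h where "h = (s - (a + b)) / 2"
  have "\<bar>h\<bar> \<le> W / 2" using s by (simp add: h_def)
  then have "(a + h) + (b + h) \<in> chan W a + chan W b"
    by (intro set_plus_intro) (auto simp: chan_def)
  also have "(a + h) + (b + h) = s" by (simp add: h_def field_simps)
  finally show "s \<in> chan W a + chan W b" .
qed

lemma chan_add_disjoint_iff:
  assumes "W \<ge> 0"
  shows "(chan W a + chan W b) \<inter> (chan W c + chan W d) = {} \<longleftrightarrow> \<bar>(a + b) - (c + d)\<bar> > 2 * W"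
proof
  assume e: "(chan W a + chan W b) \<inter> (chan W c + chan W d) = {}"
  show "\<bar>(a + b) - (c + d)\<bar> > 2 * W"
  proof (rule ccontr)
    assume "\<not> ?thesis"
    then have le: "\<bar>(a + b) - (c + d)\<bar> \<le> 2 * W" by simp
    \<comment> \<open>Each sum of channels is a closed interval of radius W, so if the centres are
      at most 2 W apart their midpoint lies in both.\<close>
    let ?s = "((a + b) + (c + d)) / 2"
    have "?s - (a + b) = - (((a + b) - (c + d)) / 2)" "?s - (c + d) = ((a + b) - (c + d)) / 2"
      by (simp_all add: field_simps)
    then have "?s \<in> (chan W a + chan W b) \<inter> (chan W c + chan W d)"
      using le by (simp only: Int_iff mem_chan_add_iff abs_minus_cancel abs_divide) simp
    then show False using e by blast
  qed
next
  assume gt: "\<bar>(a + b) - (c + d)\<bar> > 2 * W"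
  have False if "\<bar>s - (a + b)\<bar> \<le> W" "\<bar>s - (c + d)\<bar> \<le> W" for s
    using gt that by linarith
  then show "(chan W a + chan W b) \<inter> (chan W c + chan W d) = {}"
    by (auto simp: mem_chan_add_iff)
qed

lemma valid_config_separated:
  assumes "valid_config W N c" "W \<ge> 0"
    "i \<in> {1..N}" "j \<in> {1..N}" "k \<in> {1..N}" "l \<in> {1..N}" "(i, j) \<noteq> (k, l)" "(i, j) \<noteq> (l, k)"
  shows "\<bar>(c i + c j) - (c k + c l)\<bar> > 2 * W"
  using assms(1)[unfolded valid_config_def, THEN conjunct2, THEN bspec, OF assms(3), THEN bspec, OF assms(4),
      THEN bspec, OF assms(5), THEN bspec, OF assms(6), THEN mp, OF conjI[OF assms(7,8)]]
  by (simp only: chan_add_disjoint_iff[OF assms(2)])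

lemma valid_configI:
  assumes "W > 0"
    "\<And>i j k l. \<lbrakk>i \<in> {1..N}; j \<in> {1..N}; k \<in> {1..N}; l \<in> {1..N}; (i, j) \<noteq> (k, l); (i, j) \<noteq> (l, k)\<rbrakk>
       \<Longrightarrow> \<bar>(c i + c j) - (c k + c l)\<bar> > 2 * W"
  shows "valid_config W N c"
  unfolding valid_config_def
proof (intro conjI ballI impI)
  fix i j assume ij: "i \<in> {1..N}" "j \<in> {1..N}" "i \<noteq> j"
  \<comment> \<open>Comparing the sums for (i, i) and (j, i) cancels one centre and separates the
    individual centres.\<close>
  have "\<bar>(c i + c i) - (c j + c i)\<bar> > 2 * W" using ij by (intro assms(2)) auto
  then have gt: "\<bar>c i - c j\<bar> > 2 * W" by simp
  have False if "\<bar>x - c i\<bar> \<le> W / 2" "\<bar>x - c j\<bar> \<le> W / 2" for x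
    using gt that assms(1) by linarith
  then show "chan W (c i) \<inter> chan W (c j) = {}" by (auto simp: chan_def)
next
  fix n1 n2 n n3
  assume "n1 \<in> {1..N}" "n2 \<in> {1..N}" "n \<in> {1..N}" "n3 \<in> {1..N}" "(n1, n2) \<noteq> (n, n3) \<and> (n1, n2) \<noteq> (n3, n)"
  then show "(chan W (c n1) + chan W (c n2)) \<inter> (chan W (c n) + chan W (c n3)) = {}"
    using assms(1) by (subst chan_add_disjoint_iff) (auto intro!: assms(2))
qed

lemma efficiency_eq:
  assumes "W > 0" "N \<ge> 1"
  shows "efficiency W N c = real N * W / (Max (c ` {1..N}) - Min (c ` {1..N}) + W)"
proof -
  have ne: "c ` {1..N} \<noteq> {}" "finite (c ` {1..N})" using assms by auto
  obtain i where i: "i \<in> {1..N}" "Max (c ` {1..N}) = c i" using Max_in[OF ne(2,1)] by auto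
  obtain j where j: "j \<in> {1..N}" "Min (c ` {1..N}) = c j" using Min_in[OF ne(2,1)] by auto
  have le: "Min (c ` {1..N}) \<le> c k" "c k \<le> Max (c ` {1..N})" if "k \<in> {1..N}" for k
    using that ne by auto
  have bd: "Min (c ` {1..N}) - W / 2 \<le> x \<and> x \<le> Max (c ` {1..N}) + W / 2" if x: "x \<in> config_set W N c" for x
  proof -
    obtain k where "k \<in> {1..N}" "\<bar>x - c k\<bar> \<le> W / 2" using x unfolding config_set_def chan_def by blast
    then show ?thesis using le[of k] by linarith
  qed
  have "Sup (config_set W N c) = Max (c ` {1..N}) + W / 2"
  proof (rule cSup_eq_maximum)
    show "Max (c ` {1..N}) + W / 2 \<in> config_set W N c"
      unfolding config_set_def i(2) using i(1) assms(1) by (intro UN_I[of i]) (auto simp: chan_def)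
  qed (use bd in blast)
  moreover have "Inf (config_set W N c) = Min (c ` {1..N}) - W / 2"
  proof (rule cInf_eq_minimum)
    show "Min (c ` {1..N}) - W / 2 \<in> config_set W N c"
      unfolding config_set_def j(2) using j(1) assms(1) by (intro UN_I[of j]) (auto simp: chan_def)
  qed (use bd in blast)
  ultimately show ?thesis by (simp add: efficiency_def)
qed

text \<open>A crude bound whose purpose is to make the set of efficiencies bounded above, so that
  each configuration bounds the supremum \<open>eta\<close> from below.\<close>

lemma efficiency_le:
  assumes "W > 0" "N \<ge> 1"
  shows "efficiency W N c \<le> real N"
proof -
  have "Min (c ` {1..N}) \<le> Max (c ` {1..N})" using assms by (intro Min.coboundedI) (auto intro!: Max_in)
  then have "real N * W \<le> real N * (Max (c ` {1..N}) - Min (c ` {1..N}) + W)"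
    by (intro mult_left_mono) auto
  moreover have "Max (c ` {1..N}) - Min (c ` {1..N}) + W > 0"
    using \<open>Min (c ` {1..N}) \<le> Max (c ` {1..N})\<close> assms(1) by linarith
  ultimately show ?thesis unfolding efficiency_eq[OF assms] by (simp only: pos_divide_le_eq)
qed

text \<open>The centres come in arbitrary order; listing them increasingly and pulling indices back
  through n makes the bound for monotone sequences applicable.\<close>

lemma valid_config_span_ge:
  assumes W: "W > 0" and v: "valid_config W N c" and R: "R \<ge> 1" "R \<le> N"
  shows "2 * W * (real R * real (N - R) * (real R * real (N - R) - 1))
           \<le> real R * (real R + 1) * (Max (c ` {1..N}) - Min (c ` {1..N}))"
proof -
  define xs where "xs = sorted_list_of_set (c ` {1..N})"
  have sep: "\<bar>(c i + c j) - (c k + c l)\<bar> > 2 * W"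
    if "i \<in> {1..N}" "j \<in> {1..N}" "k \<in> {1..N}" "l \<in> {1..N}" "(i, j) \<noteq> (k, l)" "(i, j) \<noteq> (l, k)" for i j k l
    using valid_config_separated[OF v] W that by simp
  have "inj_on c {1..N}"
  proof (rule inj_onI)
    fix i j assume ij: "i \<in> {1..N}" "j \<in> {1..N}" "c i = c j"
    show "i = j" using sep[of i i j i] ij W by (cases "i = j") auto
  qed
  then have len: "length xs = N" by (simp add: xs_def card_image)
  have set: "set xs = c ` {1..N}" by (simp add: xs_def)
  have dis: "distinct xs" by (simp add: xs_def)
  have "\<forall>i\<in>{..<N}. \<exists>n. n \<in> {1..N} \<and> c n = xs ! i"
  proof
    fix i assume "i \<in> {..<N}"
    then have "xs ! i \<in> c ` {1..N}" using nth_mem[of i xs] len set by simp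
    then show "\<exists>n. n \<in> {1..N} \<and> c n = xs ! i" by auto
  qed
  from bchoice[OF this] obtain n where n: "\<And>i. i < N \<Longrightarrow> n i \<in> {1..N}" "\<And>i. i < N \<Longrightarrow> c (n i) = xs ! i"
    by auto
  have ninj: "n i = n j \<longleftrightarrow> i = j" if "i < N" "j < N" for i j
    using n(2)[of i] n(2)[of j] that nth_eq_iff_index_eq[OF dis, of i j] len by auto
  show ?thesis
  proof (rule sidon_span_ge[where x = "\<lambda>i. xs ! i"])
    fix i j assume "i < j" "j < N"
    then show "xs ! i < xs ! j"
      using len unfolding xs_def by (intro sorted_wrt_nth_less[OF strict_sorted_list_of_set]) auto
  next
    fix i j k l assume *: "i < N" "j < N" "k < N" "l < N" "(i, j) \<noteq> (k, l)" "(i, j) \<noteq> (l, k)"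
    have "\<bar>(c (n i) + c (n j)) - (c (n k) + c (n l))\<bar> > 2 * W"
      using * by (intro sep n(1)) (auto simp: ninj)
    then show "\<bar>(xs ! i + xs ! j) - (xs ! k + xs ! l)\<bar> > 2 * W" using * n(2) by simp
  next
    fix i assume "i < N"
    then have "xs ! i \<in> c ` {1..N}" using nth_mem[of i xs] len set by simp
    then show "Min (c ` {1..N}) \<le> xs ! i \<and> xs ! i \<le> Max (c ` {1..N})" by auto
  qed (use W R in auto)
qed

lemma ruzsa_config:
  assumes W: "W > 0" and p: "prime p" "N < p" and t: "t > 1" and N: "N \<ge> 1"
  obtains c where "valid_config W N c" "Max (c ` {1..N}) - Min (c ` {1..N}) \<le> 2 * W * t * (real p)\<^sup>2"
proof -
  obtain a :: "nat \<Rightarrow> int" where a: "\<And>i. 0 \<le> a i \<and> a i < int p * (int p - 1)"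
    "\<And>i j k l. \<lbrakk>i < p - 1; j < p - 1; k < p - 1; l < p - 1; a i + a j = a k + a l\<rbrakk> \<Longrightarrow>
       (i, j) = (k, l) \<or> (i, j) = (l, k)"
    using ruzsa_sidon[OF p(1)] by blast
  \<comment> \<open>Distinct integer sums differ by at least 1, so scaling by 2 W t with t > 1 gives
    the strict separation. The shift i - 1 maps {1..N} into the indices below p - 1, as N <
    p.\<close>
  define c where "c = (\<lambda>i. 2 * W * t * of_int (a (i - 1)))"
  have Wt: "2 * W * t > 0" using W t by simp
  show ?thesis
  proof
    show "valid_config W N c"
    proof (rule valid_configI[OF W])
      fix i j k l assume *: "i \<in> {1..N}" "j \<in> {1..N}" "k \<in> {1..N}" "l \<in> {1..N}"
        "(i, j) \<noteq> (k, l)" "(i, j) \<noteq> (l, k)"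
      let ?d = "(a (i - 1) + a (j - 1)) - (a (k - 1) + a (l - 1))"
      have lt: "i - 1 < p - 1" "j - 1 < p - 1" "k - 1 < p - 1" "l - 1 < p - 1" using *(1-4) p(2) by auto
      have "?d \<noteq> 0"
      proof
        assume "?d = 0"
        then have "a (i - 1) + a (j - 1) = a (k - 1) + a (l - 1)" by linarith
        from a(2)[OF lt this] show False using * by (auto simp: eq_diff_iff)
      qed
      then have "1 \<le> \<bar>?d\<bar>" by linarith
      then have "1 \<le> \<bar>real_of_int ?d\<bar>" by linarith
      then have "2 * W * t * 1 \<le> 2 * W * t * \<bar>real_of_int ?d\<bar>" using Wt by (intro mult_left_mono) auto
      also have "\<dots> = \<bar>2 * W * t * real_of_int ?d\<bar>" using W t by (simp add: abs_mult)
      also have "2 * W * t * real_of_int ?d = (c i + c j) - (c k + c l)"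
        by (simp add: c_def algebra_simps)
      finally have "2 * W * t \<le> \<bar>(c i + c j) - (c k + c l)\<bar>" by simp
      moreover have "2 * W * 1 < 2 * W * t" using W t by (intro mult_strict_left_mono) auto
      ultimately show "\<bar>(c i + c j) - (c k + c l)\<bar> > 2 * W" by linarith
    qed
    have c: "c i \<ge> 0" "c i \<le> 2 * W * t * (real p)\<^sup>2" for i
    proof -
      show "c i \<ge> 0" unfolding c_def using W t a(1)[of "i - 1"] by (intro mult_nonneg_nonneg) auto
      have "a (i - 1) \<le> int p * (int p - 1)" using a(1)[of "i - 1"] by simp
      also have "\<dots> \<le> (int p)\<^sup>2" by (simp add: power2_eq_square algebra_simps)
      finally have "real_of_int (a (i - 1)) \<le> real_of_int ((int p)\<^sup>2)" by (simp only: of_int_le_iff)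
      then have "real_of_int (a (i - 1)) \<le> (real p)\<^sup>2" by simp
      then show "c i \<le> 2 * W * t * (real p)\<^sup>2" unfolding c_def using Wt by (intro mult_left_mono) auto
    qed
    have "Max (c ` {1..N}) \<in> c ` {1..N}" "Min (c ` {1..N}) \<in> c ` {1..N}"
      using N by (auto intro!: Max_in Min_in)
    then obtain i j where "Max (c ` {1..N}) = c i" "Min (c ` {1..N}) = c j" by blast
    then show "Max (c ` {1..N}) - Min (c ` {1..N}) \<le> 2 * W * t * (real p)\<^sup>2"
      using c(2)[of i] c(1)[of j] by linarith
  qed
qed

section \<open>Two-sided bounds for the optimal efficiency and their limit\<close>

lemma eta_upper:
  assumes W: "W > 0" and R: "R \<ge> 1" "R < N" and pos: "real R * real (N - R) > 1"
  shows "eta W N * real N \<le> (real N)\<^sup>2 * (real R + 1) / (2 * real (N - R) * (real R * real (N - R) - 1))"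
proof -
  define m where "m = real (N - R)"
  define q where "q = m * (real R * m - 1) / (real R + 1)"
  have m: "m > 0" using R by (simp add: m_def)
  have q: "q > 0" using m pos by (simp add: q_def m_def)
  have N: "N \<ge> 1" using R by simp
  have "eta W N \<le> real N / (2 * q)"
    unfolding eta_def
  proof (rule cSUP_least)
    \<comment> \<open>Bounding a supremum from above requires a nonempty set; any prime above N
      yields a configuration.\<close>
    obtain p :: nat where "prime p" "N < p" using bigger_prime by blast
    then show "{c. valid_config W N c} \<noteq> {}" using ruzsa_config[OF W, of p N 2] N by auto
    fix c assume "c \<in> {c. valid_config W N c}"
    then have v: "valid_config W N c" by simp
    let ?L = "Max (c ` {1..N}) - Min (c ` {1..N})"
    have "2 * W * (real R * m * (real R * m - 1)) \<le> real R * (real R + 1) * ?L"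
      unfolding m_def using R by (intro valid_config_span_ge W v) auto
    then have "real R * (2 * W * (m * (real R * m - 1))) \<le> real R * ((real R + 1) * ?L)"
      by (simp only: mult_ac)
    then have "2 * W * (m * (real R * m - 1)) \<le> (real R + 1) * ?L" using R by simp
    then have L: "2 * W * q \<le> ?L" unfolding q_def by (simp add: field_simps)
    have Wq: "2 * W * q > 0" using W q by simp
    have "efficiency W N c = real N * W / (?L + W)" using W N by (simp add: efficiency_eq)
    also have "\<dots> \<le> real N * W / (2 * W * q)" using L Wq W by (intro divide_left_mono) auto
    also have "\<dots> = real N / (2 * q)" using W by simp
    finally show "efficiency W N c \<le> real N / (2 * q)" .
  qed
  then have "eta W N * real N \<le> real N / (2 * q) * real N" by (intro mult_right_mono) auto
  also have "\<dots> = (real N)\<^sup>2 * (real R + 1) / (2 * m * (real R * m - 1))"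
    by (simp add: q_def power2_eq_square mult_ac)
  finally show ?thesis by (simp add: m_def)
qed

lemma eta_lower:
  assumes W: "W > 0" and p: "prime p" "N < p" and t: "t > 1" and N: "N \<ge> 1"
  shows "eta W N \<ge> real N / (2 * t * (real p)\<^sup>2 + 1)"
proof -
  obtain c where c: "valid_config W N c" "Max (c ` {1..N}) - Min (c ` {1..N}) \<le> 2 * W * t * (real p)\<^sup>2"
    by (rule ruzsa_config[OF assms])
  have "Min (c ` {1..N}) \<le> Max (c ` {1..N})" using N by (intro Min.coboundedI) (auto intro!: Max_in)
  have "real N / (2 * t * (real p)\<^sup>2 + 1) = real N * W / ((2 * t * (real p)\<^sup>2 + 1) * W)"
    using W by simp
  also have "\<dots> = real N * W / (2 * W * t * (real p)\<^sup>2 + W)" by (simp add: algebra_simps)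
  also have "\<dots> \<le> real N * W / (Max (c ` {1..N}) - Min (c ` {1..N}) + W)"
    using c(2) W \<open>Min (c ` {1..N}) \<le> Max (c ` {1..N})\<close>
    by (intro divide_left_mono mult_pos_pos) (auto intro: add_nonneg_pos)
  also have "\<dots> = efficiency W N c" using W N by (simp add: efficiency_eq)
  also have "\<dots> \<le> eta W N" unfolding eta_def
    using c(1) efficiency_le[OF W N] by (intro cSUP_upper) (auto intro!: bdd_aboveI2)
  finally show ?thesis .
qed

lemma eta_times_N_tendsto:
  assumes W: "W > 0"
  shows "(\<lambda>N. eta W N * real N) \<longlonglongrightarrow> 1 / 2"
proof (rule order_tendstoI)
  fix a :: real assume a: "a < 1 / 2"
  \<comment> \<open>Here (1 + e)^3 combines the scaling t = 1 + e with (p / N)^2 \<le> (1 + e)^2.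
    The additional e absorbs the channel width, since 1 \<le> e N^2 once N > 1/e.\<close>
  have "((\<lambda>e::real. 1 / (2 * (1 + e) ^ 3 + e)) \<longlongrightarrow> 1 / (2 * (1 + 0) ^ 3 + 0)) (at_right 0)"
    by (intro tendsto_intros) auto
  then have "\<forall>\<^sub>F e in at_right (0::real). a < 1 / (2 * (1 + e) ^ 3 + e)"
    using a by (intro order_tendstoD(1)) auto
  then have "\<forall>\<^sub>F e in at_right (0::real). a < 1 / (2 * (1 + e) ^ 3 + e) \<and> e > 0"
    using eventually_at_right_less[of "0::real"] by eventually_elim simp
  then obtain e :: real where e: "a < 1 / (2 * (1 + e) ^ 3 + e)" "e > 0"
    using eventually_happens'[OF trivial_limit_at_right_real] by blast
  have "\<forall>\<^sub>F N in sequentially. 1 / e < real N"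
    using filterlim_real_sequentially by (simp add: filterlim_at_top_dense)
  with eventually_prime_between[OF e(2)] show "\<forall>\<^sub>F N in sequentially. a < eta W N * real N"
    using eventually_ge_at_top[of 1]
  proof eventually_elim
    case (elim N)
    then obtain p :: nat where p: "prime p" "N < p" "real p \<le> (1 + e) * real N" by blast
    let ?k = "2 * (1 + e) ^ 3"
    have N: "real N \<ge> 1" using elim by simp
    have "1 < e * real N" using elim(2) e(2) by (simp add: field_simps)
    also have "\<dots> \<le> e * (real N)\<^sup>2" using N e(2) by (intro mult_left_mono) (auto simp: power2_eq_square)
    finally have e1: "1 \<le> e * (real N)\<^sup>2" by simp
    have "(real p)\<^sup>2 \<le> ((1 + e) * real N)\<^sup>2" using p(3) by (intro power_mono) auto
    then have "2 * (1 + e) * (real p)\<^sup>2 \<le> 2 * (1 + e) * ((1 + e) * real N)\<^sup>2"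
      using e(2) by (intro mult_left_mono) auto
    also have "\<dots> = ?k * (real N)\<^sup>2" by (simp add: power2_eq_square power3_eq_cube)
    finally have d: "2 * (1 + e) * (real p)\<^sup>2 + 1 \<le> (?k + e) * (real N)\<^sup>2"
      using e1 by (simp add: algebra_simps)
    have "a < 1 / (?k + e)" by (rule e(1))
    also have "\<dots> = real N * real N / ((?k + e) * (real N)\<^sup>2)" using N by (simp add: power2_eq_square)
    also have "\<dots> \<le> real N * real N / (2 * (1 + e) * (real p)\<^sup>2 + 1)"
      using d e(2) N by (intro divide_left_mono mult_pos_pos) (auto intro: add_nonneg_pos add_pos_pos)
    also have "\<dots> = real N / (2 * (1 + e) * (real p)\<^sup>2 + 1) * real N" by simp
    also have "\<dots> \<le> eta W N * real N"
      using elim e(2) by (intro mult_right_mono eta_lower W p) auto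
    finally show ?case .
  qed
next
  fix b :: real assume b: "b > 1 / 2"
  \<comment> \<open>For fixed R the upper bound tends to (R + 1) / (2 R) as N grows, so R is chosen
    first to bring this below b.\<close>
  have "(\<lambda>R. (real R + 1) / (2 * real R)) \<longlonglongrightarrow> 1 / 2" by real_asymp
  then have "\<forall>\<^sub>F R in sequentially. (real R + 1) / (2 * real R) < b" using b by (rule order_tendstoD(2))
  then have "\<forall>\<^sub>F R in sequentially. (real R + 1) / (2 * real R) < b \<and> R \<ge> 1"
    using eventually_ge_at_top[of 1] by eventually_elim simp
  then obtain R :: nat where R: "(real R + 1) / (2 * real R) < b" "R \<ge> 1"
    using eventually_happens'[OF sequentially_bot] by blast
  define r where "r = real R"
  have r: "r > 0" using R by (simp add: r_def)
  have "(\<lambda>N. (real N)\<^sup>2 * (r + 1) / (2 * (real N - r) * (r * (real N - r) - 1))) \<longlonglongrightarrow> (r + 1) * inverse r / 2"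
    using r by real_asymp
  moreover have "(r + 1) * inverse r / 2 < b" using R(1) by (simp add: r_def field_simps)
  ultimately have "\<forall>\<^sub>F N in sequentially. (real N)\<^sup>2 * (r + 1) / (2 * (real N - r) * (r * (real N - r) - 1)) < b"
    by (rule order_tendstoD(2))
  then show "\<forall>\<^sub>F N in sequentially. eta W N * real N < b"
    \<comment> \<open>The offset 2 makes R (N - R) \<ge> 2, so the denominator of the bound is
      positive.\<close>
    using eventually_ge_at_top[of "R + 2"]
  proof eventually_elim
    case (elim N)
    have m: "real (N - R) = real N - r" "real (N - R) \<ge> 2" using elim(2) by (auto simp: r_def)
    have "real R * real (N - R) \<ge> 1 * 2" using R(2) m(2) by (intro mult_mono) auto
    then have "eta W N * real N \<le> (real N)\<^sup>2 * (real R + 1) / (2 * real (N - R) * (real R * real (N - R) - 1))"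
      using R(2) elim(2) by (intro eta_upper W) auto
    also have "\<dots> < b" using elim(1) unfolding m(1) by (simp add: r_def)
    finally show ?case .
  qed
qed

theorem theorem4:
  fixes W :: real
  assumes "W > 0"
  shows "(\<lambda>N. eta W N) \<in> O(\<lambda>N. 1 / real N) \<and>
         (\<lambda>N. eta W N * real N) \<longlonglongrightarrow> 1 / 2"
proof
  show lim: "(\<lambda>N. eta W N * real N) \<longlonglongrightarrow> 1 / 2" by (rule eta_times_N_tendsto[OF assms])
  have "((\<lambda>N. eta W N / (1 / real N)) \<longlongrightarrow> 1 / 2) sequentially" using lim by simp
  then show "(\<lambda>N. eta W N) \<in> O(\<lambda>N. 1 / real N)"
    by (rule bigoI_tendsto) (auto intro: eventually_mono[OF eventually_gt_at_top[of 0]])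
qed

end
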